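(* For every integer $n\ge1$, the third moment about the mean, $E[(X_n-E[X_n])^3]$, of the number $X_n$ of swaps of Quicksort for a list of length $n$ under Variant II is $$-\frac16 n(14n^2+57n+73)+(2n+2)H_1(n)+(n+1)^2H_2(n)+2(n+1)^3H_3(n).$$
   Context: $H_k(n)=\sum_{i=1}^n \frac1{i^k}$. Variant II of Quicksort, applied to a uniformly random ordering of $n$ distinct elements: the position $i\in\{1,\dots,n\}$ of the pivot is chosen uniformly at random; each element before the pivot that is larger than the pivot is moved to the end of the list (one swap), and each element after the pivot that is smaller than the pivot is inserted before the pivot (one swap); then the procedure is applied recursively to the two sublists. $X_n$ is the total number of swaps. Formally, let $Q(n,k,i,t)$ be the probability generating function of the number of entries that are either before position $i$ and larger than $k$, or after position $i$ and smaller than $k$, in a uniformly random permutation of $\{1,\dots,n\}$ conditioned on its $i$-th entry being $k$. The probability generating function $P_n(t)=\sum_{m\ge0}P(X_n=m)t^m$ is determined by $P_0(t)=P_1(t)=1$ and $P_n(t)=\frac1{n^2}\sum_{k=1}^n\sum_{i=1}^n P_{k-1}(t)P_{n-k}(t)Q(n,k,i,t)$ for $n\ge2$. *)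

theory Defs
  imports
    "HOL-Probability.Probability"
    "HOL-Combinatorics.Multiset_Permutations"
    "HOL-Computational_Algebra.Formal_Power_Series"
begin

definition H :: "nat \<Rightarrow> nat \<Rightarrow> real" where
  "H k n = (\<Sum>i=1..n. 1 / real i ^ k)"

text \<open>
  List positions are counted from 0. Every element out of place with respect to the pivot
  \<open>xs ! i\<close> costs one swap. The larger ones before the pivot are moved to the end of the list,
  the smaller ones after it are inserted directly before the pivot, so that the list becomes
  \<open>smaller i xs @ [xs ! i] @ larger i xs\<close>.
\<close>

definition misplaced :: "nat \<Rightarrow> 'a::linorder list \<Rightarrow> nat" where
  "misplaced i xs =
     length (filter (\<lambda>x. x > xs ! i) (take i xs)) +
     length (filter (\<lambda>x. x < xs ! i) (drop (Suc i) xs))"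

definition smaller :: "nat \<Rightarrow> 'a::linorder list \<Rightarrow> 'a list" where
  "smaller i xs =
     filter (\<lambda>x. x < xs ! i) (take i xs) @ filter (\<lambda>x. x < xs ! i) (drop (Suc i) xs)"

definition larger :: "nat \<Rightarrow> 'a::linorder list \<Rightarrow> 'a list" where
  "larger i xs =
     filter (\<lambda>x. x > xs ! i) (drop (Suc i) xs) @ filter (\<lambda>x. x > xs ! i) (take i xs)"

lemma length_smaller: "i < length xs \<Longrightarrow> length (smaller i xs) < length xs"
  and length_larger: "i < length xs \<Longrightarrow> length (larger i xs) < length xs"
proof -
  assume i: "i < length xs"
  have 1: "length (filter P (take i xs)) \<le> i" for P
    using le_trans[OF length_filter_le[of P "take i xs"], of i] by simp
  have 2: "length (filter P (drop (Suc i) xs)) \<le> length xs - Suc i" for P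
    using length_filter_le[of P "drop (Suc i) xs"] by simp
  show "length (smaller i xs) < length xs"
    using i 1[of "\<lambda>x. x < xs ! i"] 2[of "\<lambda>x. x < xs ! i"] unfolding smaller_def by simp
  show "length (larger i xs) < length xs"
    using i 1[of "\<lambda>x. x > xs ! i"] 2[of "\<lambda>x. x > xs ! i"] unfolding larger_def by simp
qed

text \<open>The number of swaps on a given list is random through the choice of the pivots.\<close>

function swaps_list :: "'a::linorder list \<Rightarrow> nat pmf" where
  "swaps_list xs =
     (if length xs \<le> 1 then return_pmf 0
      else do {
        i \<leftarrow> pmf_of_set {..<length xs};
        a \<leftarrow> swaps_list (smaller i xs);
        b \<leftarrow> swaps_list (larger i xs);
        return_pmf (misplaced i xs + a + b)
      })"
  by pat_completeness auto

termination
proof (relation "Wellfounded.measure length", goal_cases)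
  case (2 xs i)
  then show ?case by (subst (asm) set_pmf_of_set) (auto intro: length_smaller simp: lessThan_empty_iff)
next
  case (3 xs i)
  then show ?case by (subst (asm) set_pmf_of_set) (auto intro: length_larger simp: lessThan_empty_iff)
qed auto

declare swaps_list.simps [simp del]

text \<open>The distribution of $X_n$.\<close>

definition quicksort_swaps :: "nat \<Rightarrow> nat pmf" where
  "quicksort_swaps n = pmf_of_set (permutations_of_set {1..n}) \<bind> swaps_list"


definition pgf :: "nat pmf \<Rightarrow> real fps" where
  "pgf p = Abs_fps (pmf p)"

text \<open>
  The distribution whose generating function is $Q(n,k,i,t)$, where \<open>i\<close> is counted from 1.
\<close>

definition Q_pmf :: "nat \<Rightarrow> nat \<Rightarrow> nat \<Rightarrow> nat pmf" where
  "Q_pmf n k i =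
     map_pmf (\<lambda>xs. card {j \<in> {1..n}. j < i \<and> xs ! (j - 1) > k \<or> j > i \<and> xs ! (j - 1) < k})
       (cond_pmf (pmf_of_set (permutations_of_set {1..n})) {xs. xs ! (i - 1) = k})"

lemma smaller_map:
  assumes "i < length xs" "\<And>x. x \<in> set xs \<Longrightarrow> f x < f (xs ! i) \<longleftrightarrow> x < xs ! i"
  shows "smaller i (map f xs) = map f (smaller i xs)"
proof -
  have "filter (\<lambda>x. f x < f (xs ! i)) (take i xs) = filter (\<lambda>x. x < xs ! i) (take i xs)"
    "filter (\<lambda>x. f x < f (xs ! i)) (drop (Suc i) xs) = filter (\<lambda>x. x < xs ! i) (drop (Suc i) xs)"
    using assms by (auto intro!: filter_cong dest: in_set_takeD in_set_dropD)
  then show ?thesis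
    using assms(1) by (simp add: smaller_def take_map drop_map filter_map o_def)
qed

lemma larger_map:
  assumes "i < length xs" "\<And>x. x \<in> set xs \<Longrightarrow> f x > f (xs ! i) \<longleftrightarrow> x > xs ! i"
  shows "larger i (map f xs) = map f (larger i xs)"
proof -
  have "filter (\<lambda>x. f (xs ! i) < f x) (take i xs) = filter (\<lambda>x. xs ! i < x) (take i xs)"
    "filter (\<lambda>x. f (xs ! i) < f x) (drop (Suc i) xs) = filter (\<lambda>x. xs ! i < x) (drop (Suc i) xs)"
    using assms by (auto intro!: filter_cong dest: in_set_takeD in_set_dropD)
  then show ?thesis
    using assms(1) by (simp add: larger_def take_map drop_map filter_map o_def)
qed

lemma misplaced_map:
  assumes "i < length xs" "\<And>x. x \<in> set xs \<Longrightarrow> f x < f (xs ! i) \<longleftrightarrow> x < xs ! i"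
    "\<And>x. x \<in> set xs \<Longrightarrow> f x > f (xs ! i) \<longleftrightarrow> x > xs ! i"
  shows "misplaced i (map f xs) = misplaced i xs"
proof -
  have "filter (\<lambda>x. f (xs ! i) < f x) (take i xs) = filter (\<lambda>x. xs ! i < x) (take i xs)"
    "filter (\<lambda>x. f x < f (xs ! i)) (drop (Suc i) xs) = filter (\<lambda>x. x < xs ! i) (drop (Suc i) xs)"
    using assms by (auto intro!: filter_cong dest: in_set_takeD in_set_dropD)
  then show ?thesis
    using assms(1) by (simp add: misplaced_def take_map drop_map filter_map o_def)
qed

lemma set_smaller: "i < length xs \<Longrightarrow> set (smaller i xs) = {x \<in> set xs. x < xs ! i}"
  and set_larger: "i < length xs \<Longrightarrow> set (larger i xs) = {x \<in> set xs. x > xs ! i}"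
  and distinct_smaller: "distinct xs \<Longrightarrow> i < length xs \<Longrightarrow> distinct (smaller i xs)"
  and distinct_larger: "distinct xs \<Longrightarrow> i < length xs \<Longrightarrow> distinct (larger i xs)"
proof -
  assume i: "i < length xs"
  then have eq: "xs = take i xs @ xs ! i # drop (Suc i) xs"
    by (rule id_take_nth_drop)
  have s: "set xs = set (take i xs) \<union> {xs ! i} \<union> set (drop (Suc i) xs)"
    by (subst eq) auto
  show "set (smaller i xs) = {x \<in> set xs. x < xs ! i}"
    unfolding smaller_def s by auto
  show "set (larger i xs) = {x \<in> set xs. x > xs ! i}"
    unfolding larger_def s by auto
  assume d: "distinct xs"
  have "set (take i xs) \<inter> set (drop (Suc i) xs) = {}"
    using d by (simp add: set_take_disj_set_drop_if_distinct)
  then show "distinct (smaller i xs)" "distinct (larger i xs)"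
    using d unfolding smaller_def larger_def by auto
qed

lemma swaps_list_map:
  fixes f :: "'a::linorder \<Rightarrow> 'b::linorder"
  assumes "strict_mono_on (set xs) f"
  shows "swaps_list (map f xs) = swaps_list xs"
  using assms
proof (induction xs rule: swaps_list.induct)
  case (1 xs)
  show ?case
  proof (cases "length xs \<le> 1")
    case True
    then show ?thesis by (simp add: swaps_list.simps)
  next
    case False
    have sup: "set_pmf (pmf_of_set {..<length xs}) = {..<length xs}"
      using False by (intro set_pmf_of_set) (auto simp: lessThan_empty_iff)
    have less: "f x < f y \<longleftrightarrow> x < y" if "x \<in> set xs" "y \<in> set xs" for x y
      using "1.prems" that by (simp add: strict_mono_on_less)
    have eqs: "smaller i (map f xs) = map f (smaller i xs)" "larger i (map f xs) = map f (larger i xs)"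
      "misplaced i (map f xs) = misplaced i xs" if "i < length xs" for i
      using that by (auto intro!: smaller_map larger_map misplaced_map simp: less)
    have IH: "swaps_list (map f (smaller i xs)) = swaps_list (smaller i xs)"
      "swaps_list (map f (larger i xs)) = swaps_list (larger i xs)" if "i < length xs" for i
    proof -
      have "strict_mono_on (set (smaller i xs)) f" "strict_mono_on (set (larger i xs)) f"
        using "1.prems" that by (auto simp: set_smaller set_larger strict_mono_on_def)
      then show "swaps_list (map f (smaller i xs)) = swaps_list (smaller i xs)"
        "swaps_list (map f (larger i xs)) = swaps_list (larger i xs)"
        using "1.IH" False that sup set_pmf_not_empty[of "swaps_list (smaller i xs)"]
        by (auto simp: ex_in_conv[symmetric])
    qed
    show ?thesis
      using False
      by (subst (1 2) swaps_list.simps) (auto simp: sup eqs IH intro!: bind_pmf_cong)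
  qed
qed

lemma swaps_list_permutations_of_set:
  "pmf_of_set (permutations_of_set {Suc k..k + m}) \<bind> swaps_list = quicksort_swaps m"
proof -
  have "permutations_of_set {Suc k..k + m} = map ((+) k) ` permutations_of_set {1..m}"
    using permutations_of_set_image_inj[of "(+) k" "{1..m}"] by (simp add: image_add_atLeastAtMost add.commute)
  then have "pmf_of_set (permutations_of_set {Suc k..k + m}) =
      map_pmf (map ((+) k)) (pmf_of_set (permutations_of_set {1..m}))"
    by (subst map_pmf_of_set_inj) (auto intro!: inj_onI dest: map_injective)
  then show ?thesis
    by (simp add: bind_map_pmf quicksort_swaps_def swaps_list_map strict_mono_on_def)
qed

lemma map_permutes_permutations_of_set:
  assumes "finite A" "l \<in> permutations_of_set A"
  shows "map_pmf (\<lambda>\<sigma>. map \<sigma> l) (pmf_of_set {\<sigma>. \<sigma> permutes A}) = pmf_of_set (permutations_of_set A)"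
proof (rule map_pmf_of_set_bij_betw)
  have l: "set l = A" "distinct l"
    using assms by (auto dest: permutations_of_setD)
  have inj: "inj_on (\<lambda>\<sigma>. map \<sigma> l) {\<sigma>. \<sigma> permutes A}"
  proof (rule inj_onI)
    fix \<sigma> \<tau> assume \<sigma>: "\<sigma> \<in> {\<sigma>. \<sigma> permutes A}" "\<tau> \<in> {\<sigma>. \<sigma> permutes A}" "map \<sigma> l = map \<tau> l"
    show "\<sigma> = \<tau>"
    proof
      fix x show "\<sigma> x = \<tau> x"
        using \<sigma> l by (cases "x \<in> A") (auto simp: permutes_def map_eq_conv)
    qed
  qed
  have sub: "(\<lambda>\<sigma>. map \<sigma> l) ` {\<sigma>. \<sigma> permutes A} \<subseteq> permutations_of_set A"
    using l by (auto simp: permutations_of_set_def distinct_map permutes_image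
        permutes_inj_on dest: permutes_imp_bij bij_betw_imp_inj_on)
  have "card ((\<lambda>\<sigma>. map \<sigma> l) ` {\<sigma>. \<sigma> permutes A}) = card (permutations_of_set A)"
    using assms(1) by (simp add: card_image[OF inj] card_permutations)
  then show "bij_betw (\<lambda>\<sigma>. map \<sigma> l) {\<sigma>. \<sigma> permutes A} (permutations_of_set A)"
    using inj sub by (simp add: bij_betw_def card_subset_eq)
qed (use assms in \<open>auto simp: finite_permutations intro: permutes_id\<close>)


definition perms_at :: "nat \<Rightarrow> nat \<Rightarrow> nat \<Rightarrow> nat list set" where
  "perms_at n k i = {xs \<in> permutations_of_set {1..n}. xs ! i = k}"

lemma perms_atD:
  assumes "xs \<in> perms_at n k i"
  shows "distinct xs" "set xs = {1..n}" "length xs = n" "xs ! i = k"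
  using assms distinct_card[of xs] by (auto simp: perms_at_def permutations_of_set_def)

lemma finite_perms_at: "finite (perms_at n k i)"
  by (simp add: perms_at_def)

lemma bij_betw_map_perms_at:
  assumes "\<sigma> permutes {1..n}" "i < n"
  shows "bij_betw (map \<sigma>) (perms_at n k i) (perms_at n (\<sigma> k) i)"
proof -
  have *: "map \<sigma> xs \<in> perms_at n (\<sigma> k) i" if "\<sigma> permutes {1..n}" "xs \<in> perms_at n k i" for \<sigma> xs k
    using that perms_atD[OF that(2)] assms(2)
    by (auto simp: perms_at_def permutations_of_set_def distinct_map permutes_image
        permutes_inj_on permutes_in_image)
  have inv: "inv \<sigma> permutes {1..n}"
    using assms by (simp add: permutes_inv)
  show ?thesis
  proof (rule bij_betw_byWitness[where f' = "map (inv \<sigma>)"])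
    show "map (inv \<sigma>) ` perms_at n (\<sigma> k) i \<subseteq> perms_at n k i"
      using *[OF inv, of _ "\<sigma> k"] assms by (auto simp: permutes_inverses)
  qed (use * assms in \<open>auto simp: permutes_inv_o o_def permutes_inverses\<close>)
qed

lemma perms_at_nonempty:
  assumes "k \<in> {1..n}" "i < n"
  shows "perms_at n k i \<noteq> {}"
proof -
  obtain xs where xs: "xs \<in> permutations_of_set {1..n}"
    using permutations_of_set_empty_iff[of "{1..n}"] by blast
  then have l: "length xs = n"
    by (metis length_finite_permutations_of_set card_atLeastAtMost diff_Suc_1)
  then have "xs ! i \<in> {1..n}"
    using xs assms by (metis nth_mem permutations_of_setD(1))
  then have p: "Transposition.transpose (xs ! i) k permutes {1..n}"
    using assms by (simp add: permutes_swap_id)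
  have "xs \<in> perms_at n (xs ! i) i"
    using xs by (simp add: perms_at_def)
  then show ?thesis
    using bij_betw_map_perms_at[OF p assms(2), of "xs ! i"] by (auto simp: bij_betw_def)
qed

lemma pmf_of_set_permutations_split:
  assumes "i < n"
  shows "pmf_of_set (permutations_of_set {1..n}) =
    do {k \<leftarrow> pmf_of_set {1..n}; pmf_of_set (perms_at n k i)}"
proof -
  have un: "permutations_of_set {1..n} = (\<Union>k\<in>{1..n}. perms_at n k i)"
  proof (intro equalityI subsetI)
    fix xs assume xs: "xs \<in> permutations_of_set {1..n}"
    then have "length xs = n"
      by (metis length_finite_permutations_of_set card_atLeastAtMost diff_Suc_1)
    then have "xs ! i \<in> {1..n}"
      using xs assms by (metis nth_mem permutations_of_setD(1))
    then show "xs \<in> (\<Union>k\<in>{1..n}. perms_at n k i)"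
      using xs by (auto simp: perms_at_def)
  qed (auto simp: perms_at_def)
  show ?thesis
    unfolding un
  proof (rule pmf_of_set_UN[where n = "card (perms_at n 1 i)"])
    fix k assume k: "k \<in> {1..n}"
    then have "Transposition.transpose 1 k permutes {1..n}"
      using assms by (intro permutes_swap_id) auto
    from bij_betw_map_perms_at[OF this assms, of 1]
    show "card (perms_at n k i) = card (perms_at n 1 i)"
      by (simp add: bij_betw_same_card)
  qed (use assms perms_at_nonempty in \<open>auto simp: perms_at_def disjoint_family_on_def\<close>)
qed

text \<open>
  Given the pivot and its position, the two sublists are uniformly distributed and independent of
  each other and of the number of swaps in the partitioning step.
\<close>

lemma partition_pmf:
  assumes k: "k \<in> {1..n}" and i: "i < n"
  shows "do {xs \<leftarrow> pmf_of_set (perms_at n k i); f (misplaced i xs) (smaller i xs) (larger i xs)} =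
    do {
      c \<leftarrow> map_pmf (misplaced i) (pmf_of_set (perms_at n k i));
      l \<leftarrow> pmf_of_set (permutations_of_set {1..<k});
      u \<leftarrow> pmf_of_set (permutations_of_set {k<..n});
      f c l u
    }" (is "?lhs = ?rhs")
proof -
  define F where "F = pmf_of_set (perms_at n k i)"
  define A where "A = pmf_of_set {\<sigma>. \<sigma> permutes {1..<k}}"
  define B where "B = pmf_of_set {\<tau>. \<tau> permutes {k<..n}}"
  have setF: "set_pmf F = perms_at n k i"
    unfolding F_def using perms_at_nonempty[OF k i] finite_perms_at by (rule set_pmf_of_set)
  have setA: "set_pmf A = {\<sigma>. \<sigma> permutes {1..<k}}"
    unfolding A_def by (rule set_pmf_of_set) (auto intro: permutes_id simp: finite_permutations)
  have setB: "set_pmf B = {\<tau>. \<tau> permutes {k<..n}}"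
    unfolding B_def by (rule set_pmf_of_set) (auto intro: permutes_id simp: finite_permutations)
  have inv: "map_pmf (map (\<sigma> \<circ> \<tau>)) F = F"
    if "\<sigma> permutes {1..<k}" "\<tau> permutes {k<..n}" for \<sigma> \<tau>
  proof -
    have "\<sigma> \<circ> \<tau> permutes {1..n}"
      using that k by (intro permutes_compose) (auto elim!: permutes_subset)
    moreover have "(\<sigma> \<circ> \<tau>) k = k"
      using that by (simp add: permutes_not_in)
    ultimately show ?thesis
      unfolding F_def using bij_betw_map_perms_at[of "\<sigma> \<circ> \<tau>" n i k] i perms_at_nonempty[OF k i]
      by (intro map_pmf_of_set_bij_betw) (auto simp: finite_perms_at)
  qed
  have step: "misplaced i (map (\<sigma> \<circ> \<tau>) xs) = misplaced i xs"
      "smaller i (map (\<sigma> \<circ> \<tau>) xs) = map \<sigma> (smaller i xs)"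
      "larger i (map (\<sigma> \<circ> \<tau>) xs) = map \<tau> (larger i xs)"
    if \<sigma>: "\<sigma> permutes {1..<k}" and \<tau>: "\<tau> permutes {k<..n}" and xs: "xs \<in> perms_at n k i" for \<sigma> \<tau> xs
  proof -
    note x = perms_atD[OF xs]
    have v: "(\<sigma> \<circ> \<tau>) y = (if y < k then \<sigma> y else if y > k then \<tau> y else y)"
        "y < k \<Longrightarrow> \<sigma> y < k" "y > k \<Longrightarrow> \<tau> y > k" if "y \<in> {1..n}" for y
    proof -
      have 1: "\<sigma> y \<in> {1..<k} \<longleftrightarrow> y \<in> {1..<k}" and 2: "\<tau> y \<in> {k<..n} \<longleftrightarrow> y \<in> {k<..n}"
        using permutes_in_image[OF \<sigma>] permutes_in_image[OF \<tau>] by auto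
      have 3: "y \<notin> {1..<k} \<Longrightarrow> \<sigma> y = y" "y \<notin> {k<..n} \<Longrightarrow> \<tau> y = y" "\<tau> y \<notin> {1..<k} \<Longrightarrow> \<sigma> (\<tau> y) = \<tau> y"
        using \<sigma> \<tau> by (auto simp: permutes_not_in)
      show "y < k \<Longrightarrow> \<sigma> y < k" "y > k \<Longrightarrow> \<tau> y > k"
        using 1 2 that by auto
      show "(\<sigma> \<circ> \<tau>) y = (if y < k then \<sigma> y else if y > k then \<tau> y else y)"
        using 2 3 that by auto
    qed
    have k': "k \<in> set xs" using x k by auto
    have less: "(\<sigma> \<circ> \<tau>) y < (\<sigma> \<circ> \<tau>) (xs ! i) \<longleftrightarrow> y < xs ! i"
      "(\<sigma> \<circ> \<tau>) (xs ! i) < (\<sigma> \<circ> \<tau>) y \<longleftrightarrow> xs ! i < y" if "y \<in> set xs" for y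
    proof -
      have y: "y \<in> {1..n}" using that x by simp
      show "(\<sigma> \<circ> \<tau>) y < (\<sigma> \<circ> \<tau>) (xs ! i) \<longleftrightarrow> y < xs ! i"
        "(\<sigma> \<circ> \<tau>) (xs ! i) < (\<sigma> \<circ> \<tau>) y \<longleftrightarrow> xs ! i < y"
        unfolding x(4) v(1)[OF y] v(1)[OF k] using v(2,3)[OF y] by auto
    qed
    have il: "i < length xs" using x i by simp
    show "misplaced i (map (\<sigma> \<circ> \<tau>) xs) = misplaced i xs"
      by (rule misplaced_map[OF il less])
    have "smaller i (map (\<sigma> \<circ> \<tau>) xs) = map (\<sigma> \<circ> \<tau>) (smaller i xs)"
      by (rule smaller_map[OF il less(1)])
    also have "\<dots> = map \<sigma> (smaller i xs)"
      by (rule map_cong[OF refl]) (use x i v(1) in \<open>auto simp: set_smaller\<close>)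
    finally show "smaller i (map (\<sigma> \<circ> \<tau>) xs) = map \<sigma> (smaller i xs)" .
    have "larger i (map (\<sigma> \<circ> \<tau>) xs) = map (\<sigma> \<circ> \<tau>) (larger i xs)"
      by (rule larger_map[OF il less(2)])
    also have "\<dots> = map \<tau> (larger i xs)"
      by (rule map_cong[OF refl]) (use x i v(1) in \<open>auto simp: set_larger\<close>)
    finally show "larger i (map (\<sigma> \<circ> \<tau>) xs) = map \<tau> (larger i xs)" .
  qed
  let ?g = "\<lambda>xs. f (misplaced i xs) (smaller i xs) (larger i xs)"
  have "?lhs = F \<bind> ?g"
    by (simp add: F_def)
  also have "\<dots> = do {\<sigma> \<leftarrow> A; \<tau> \<leftarrow> B; F \<bind> ?g}"
    by simp
  also have "\<dots> = do {\<sigma> \<leftarrow> A; \<tau> \<leftarrow> B; map_pmf (map (\<sigma> \<circ> \<tau>)) F \<bind> ?g}"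
    by (intro bind_pmf_cong refl) (simp add: setA setB inv)
  also have "\<dots> = do {\<sigma> \<leftarrow> A; \<tau> \<leftarrow> B; xs \<leftarrow> F; ?g (map (\<sigma> \<circ> \<tau>) xs)}"
    unfolding bind_map_pmf ..
  also have "\<dots> = do {\<sigma> \<leftarrow> A; \<tau> \<leftarrow> B; xs \<leftarrow> F;
      f (misplaced i xs) (map \<sigma> (smaller i xs)) (map \<tau> (larger i xs))}"
    by (intro bind_pmf_cong refl, unfold setA setB setF mem_Collect_eq) (simp only: step)
  also have "\<dots> = do {\<sigma> \<leftarrow> A; xs \<leftarrow> F; \<tau> \<leftarrow> B;
      f (misplaced i xs) (map \<sigma> (smaller i xs)) (map \<tau> (larger i xs))}"
    by (subst bind_commute_pmf[of B F]) (rule refl)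
  also have "\<dots> = do {xs \<leftarrow> F; \<sigma> \<leftarrow> A; \<tau> \<leftarrow> B;
      f (misplaced i xs) (map \<sigma> (smaller i xs)) (map \<tau> (larger i xs))}"
    by (rule bind_commute_pmf)
  also have "\<dots> = do {xs \<leftarrow> F; l \<leftarrow> map_pmf (\<lambda>\<sigma>. map \<sigma> (smaller i xs)) A;
      u \<leftarrow> map_pmf (\<lambda>\<tau>. map \<tau> (larger i xs)) B; f (misplaced i xs) l u}"
    unfolding bind_map_pmf ..
  also have "\<dots> = do {xs \<leftarrow> F; l \<leftarrow> pmf_of_set (permutations_of_set {1..<k});
      u \<leftarrow> pmf_of_set (permutations_of_set {k<..n}); f (misplaced i xs) l u}"
  proof (rule bind_pmf_cong[OF refl])
    fix xs assume "xs \<in> set_pmf F"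
    then have xs: "xs \<in> perms_at n k i" by (simp add: setF)
    note x = perms_atD[OF xs]
    have "smaller i xs \<in> permutations_of_set {1..<k}" "larger i xs \<in> permutations_of_set {k<..n}"
      using x k i by (auto simp: permutations_of_set_def set_smaller set_larger
          distinct_smaller distinct_larger)
    then have "map_pmf (\<lambda>\<sigma>. map \<sigma> (smaller i xs)) A = pmf_of_set (permutations_of_set {1..<k})"
      "map_pmf (\<lambda>\<tau>. map \<tau> (larger i xs)) B = pmf_of_set (permutations_of_set {k<..n})"
      unfolding A_def B_def by (simp_all add: map_permutes_permutations_of_set)
    then show "do {l \<leftarrow> map_pmf (\<lambda>\<sigma>. map \<sigma> (smaller i xs)) A;
        u \<leftarrow> map_pmf (\<lambda>\<tau>. map \<tau> (larger i xs)) B; f (misplaced i xs) l u} =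
      do {l \<leftarrow> pmf_of_set (permutations_of_set {1..<k});
        u \<leftarrow> pmf_of_set (permutations_of_set {k<..n}); f (misplaced i xs) l u}"
      by simp
  qed
  also have "\<dots> = ?rhs"
    unfolding F_def bind_map_pmf ..
  finally show ?thesis .
qed

lemma misplaced_eq_card:
  assumes "length xs = n" "i < n" "xs ! i = k"
  shows "misplaced i xs =
    card {j \<in> {1..n}. j < Suc i \<and> xs ! (j - 1) > k \<or> j > Suc i \<and> xs ! (j - 1) < k}"
proof -
  define A where "A = {j. j < i \<and> xs ! j > k}"
  define B where "B = {j. j < n - Suc i \<and> xs ! (Suc i + j) < k}"
  have "misplaced i xs = card A + card B"
    using assms by (simp add: misplaced_def length_filter_conv_card A_def B_def cong: conj_cong)
  also have "\<dots> = card (Suc ` A) + card ((\<lambda>j. Suc (Suc (i + j))) ` B)"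
    by (simp add: card_image inj_on_def)
  also have "\<dots> = card (Suc ` A \<union> (\<lambda>j. Suc (Suc (i + j))) ` B)"
    by (rule card_Un_disjoint[symmetric]) (auto simp: A_def B_def)
  also have "Suc ` A \<union> (\<lambda>j. Suc (Suc (i + j))) ` B =
      {j \<in> {1..n}. j < Suc i \<and> xs ! (j - 1) > k \<or> j > Suc i \<and> xs ! (j - 1) < k}" (is "?L = ?R")
  proof (intro equalityI subsetI)
    fix j assume j: "j \<in> ?R"
    show "j \<in> ?L"
    proof (cases "j < Suc i")
      case True
      then have "j - 1 \<in> A" "j = Suc (j - 1)" using j by (auto simp: A_def)
      then show ?thesis by blast
    next
      case False
      then have "Suc i < j" using j by auto
      then obtain d where d: "j = Suc (Suc (i + d))"
        by (auto simp: less_iff_Suc_add)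
      then have "d \<in> B" using j by (auto simp: B_def)
      then show ?thesis using d by blast
    qed
  qed (use assms in \<open>auto simp: A_def B_def\<close>)
  finally show ?thesis .
qed

lemma Q_pmf_eq:
  assumes "k \<in> {1..n}" "i < n"
  shows "Q_pmf n k (Suc i) = map_pmf (misplaced i) (pmf_of_set (perms_at n k i))"
proof -
  have eq: "permutations_of_set {1..n} \<inter> {xs. xs ! (Suc i - 1) = k} = perms_at n k i"
    by (auto simp: perms_at_def)
  have "cond_pmf (pmf_of_set (permutations_of_set {1..n})) {xs. xs ! (Suc i - 1) = k} =
      pmf_of_set (perms_at n k i)"
  proof (rule pmf_eqI)
    fix xs
    have "set_pmf (pmf_of_set (permutations_of_set {1..n})) \<inter> {xs. xs ! (Suc i - 1) = k} \<noteq> {}"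
      using perms_at_nonempty[OF assms] eq by simp
    then show "pmf (cond_pmf (pmf_of_set (permutations_of_set {1..n})) {xs. xs ! (Suc i - 1) = k}) xs =
        pmf (pmf_of_set (perms_at n k i)) xs"
      using perms_at_nonempty[OF assms]
      by (simp only: pmf_cond measure_pmf_of_set pmf_of_set permutations_of_set_empty_iff
          finite_permutations_of_set finite_atLeastAtMost finite_perms_at eq not_False_eq_True simp_thms)
        (auto simp: perms_at_def indicator_def)
  qed
  then show ?thesis
    unfolding Q_pmf_def using assms(2) perms_at_nonempty[OF assms]
    by (auto intro!: map_pmf_cong misplaced_eq_card[symmetric, simplified] dest: perms_atD
        simp: set_pmf_of_set[OF perms_at_nonempty[OF assms] finite_perms_at])
qed

lemma quicksort_swaps_rec:
  assumes "n \<ge> 2"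
  shows "quicksort_swaps n =
    do {
      i \<leftarrow> pmf_of_set {..<n};
      k \<leftarrow> pmf_of_set {1..n};
      c \<leftarrow> Q_pmf n k (Suc i);
      a \<leftarrow> quicksort_swaps (k - 1);
      b \<leftarrow> quicksort_swaps (n - k);
      return_pmf (c + a + b)
    }"
proof -
  define S where "S = pmf_of_set (permutations_of_set {1..n})"
  define g :: "nat \<Rightarrow> nat list \<Rightarrow> nat list \<Rightarrow> nat pmf" where
    "g = (\<lambda>c l u. do {a \<leftarrow> swaps_list l; b \<leftarrow> swaps_list u; return_pmf (c + a + b)})"
  have sw: "swaps_list xs = do {i \<leftarrow> pmf_of_set {..<n}; g (misplaced i xs) (smaller i xs) (larger i xs)}"
    if "xs \<in> set_pmf S" for xs
  proof -
    have "length xs = n"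
      using that by (auto simp: S_def length_finite_permutations_of_set)
    then show ?thesis
      using assms by (subst swaps_list.simps) (simp add: g_def)
  qed
  have "quicksort_swaps n = S \<bind> swaps_list"
    by (simp add: quicksort_swaps_def S_def)
  also have "\<dots> = do {xs \<leftarrow> S; i \<leftarrow> pmf_of_set {..<n}; g (misplaced i xs) (smaller i xs) (larger i xs)}"
    by (intro bind_pmf_cong refl sw)
  also have "\<dots> = do {i \<leftarrow> pmf_of_set {..<n}; xs \<leftarrow> S; g (misplaced i xs) (smaller i xs) (larger i xs)}"
    by (rule bind_commute_pmf)
  also have "\<dots> = do {i \<leftarrow> pmf_of_set {..<n}; k \<leftarrow> pmf_of_set {1..n}; c \<leftarrow> Q_pmf n k (Suc i);
      a \<leftarrow> quicksort_swaps (k - 1); b \<leftarrow> quicksort_swaps (n - k); return_pmf (c + a + b)}"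
  proof (intro bind_pmf_cong refl)
    fix i assume "i \<in> set_pmf (pmf_of_set {..<n})"
    then have i: "i < n"
      using assms by (subst (asm) set_pmf_of_set) (auto simp: lessThan_empty_iff)
    have "do {xs \<leftarrow> S; g (misplaced i xs) (smaller i xs) (larger i xs)} =
      do {k \<leftarrow> pmf_of_set {1..n}; xs \<leftarrow> pmf_of_set (perms_at n k i);
        g (misplaced i xs) (smaller i xs) (larger i xs)}"
      unfolding S_def pmf_of_set_permutations_split[OF i] bind_assoc_pmf ..
    also have "\<dots> = do {k \<leftarrow> pmf_of_set {1..n}; c \<leftarrow> Q_pmf n k (Suc i);
      a \<leftarrow> quicksort_swaps (k - 1); b \<leftarrow> quicksort_swaps (n - k); return_pmf (c + a + b)}"
    proof (intro bind_pmf_cong refl)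
      fix k assume "k \<in> set_pmf (pmf_of_set {1..n})"
      then have k: "k \<in> {1..n}"
        using assms by (subst (asm) set_pmf_of_set) auto
      have s: "{1..<k} = {Suc 0..0 + (k - 1)}" and l: "{k<..n} = {Suc k..k + (n - k)}"
        using k by auto
      have "do {xs \<leftarrow> pmf_of_set (perms_at n k i); g (misplaced i xs) (smaller i xs) (larger i xs)} =
        do {c \<leftarrow> Q_pmf n k (Suc i); l \<leftarrow> pmf_of_set (permutations_of_set {1..<k});
          u \<leftarrow> pmf_of_set (permutations_of_set {k<..n}); g c l u}"
        unfolding Q_pmf_eq[OF k i] by (rule partition_pmf[OF k i])
      also have "\<dots> = do {c \<leftarrow> Q_pmf n k (Suc i); l \<leftarrow> pmf_of_set (permutations_of_set {1..<k});
          a \<leftarrow> swaps_list l; u \<leftarrow> pmf_of_set (permutations_of_set {k<..n});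
          b \<leftarrow> swaps_list u; return_pmf (c + a + b)}"
        unfolding g_def by (intro bind_pmf_cong refl) (rule bind_commute_pmf)
      also have "\<dots> = do {c \<leftarrow> Q_pmf n k (Suc i);
          a \<leftarrow> pmf_of_set (permutations_of_set {1..<k}) \<bind> swaps_list;
          b \<leftarrow> pmf_of_set (permutations_of_set {k<..n}) \<bind> swaps_list; return_pmf (c + a + b)}"
        unfolding bind_assoc_pmf ..
      also have "\<dots> = do {c \<leftarrow> Q_pmf n k (Suc i);
        a \<leftarrow> quicksort_swaps (k - 1); b \<leftarrow> quicksort_swaps (n - k); return_pmf (c + a + b)}"
        unfolding s l swaps_list_permutations_of_set ..
      finally show "do {xs \<leftarrow> pmf_of_set (perms_at n k i);
          g (misplaced i xs) (smaller i xs) (larger i xs)} = \<dots>" .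
    qed
    finally show "do {xs \<leftarrow> S; g (misplaced i xs) (smaller i xs) (larger i xs)} = \<dots>" .
  qed
  finally show ?thesis .
qed

lemma pgf_add:
  "pgf (do {a \<leftarrow> p; b \<leftarrow> q; return_pmf (a + b)}) = pgf p * pgf q"
proof (rule fps_ext)
  fix m
  have "do {a \<leftarrow> p; b \<leftarrow> q; return_pmf (a + b)} = map_pmf (\<lambda>(a, b). a + b) (pair_pmf p q)"
    by (simp add: pair_pmf_def map_bind_pmf map_return_pmf)
  then have "fps_nth (pgf (do {a \<leftarrow> p; b \<leftarrow> q; return_pmf (a + b)})) m =
      measure (pair_pmf p q) ((\<lambda>(a, b). a + b) -` {m})"
    by (simp add: pgf_def pmf_map)
  also have "(\<lambda>(a, b). a + b) -` {m} = (\<lambda>j. (j, m - j)) ` {0..m}"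
    by (auto simp: image_iff)
  also have "measure (pair_pmf p q) \<dots> = (\<Sum>j=0..m. pmf p j * pmf q (m - j))"
    by (subst measure_measure_pmf_finite) (auto simp: sum.reindex inj_on_def pmf_pair)
  also have "\<dots> = fps_nth (pgf p * pgf q) m"
    by (simp add: pgf_def fps_mult_nth)
  finally show "fps_nth (pgf (do {a \<leftarrow> p; b \<leftarrow> q; return_pmf (a + b)})) m = fps_nth (pgf p * pgf q) m" .
qed

lemma pgf_bind_pmf_of_set:
  assumes "A \<noteq> {}" "finite A"
  shows "pgf (pmf_of_set A \<bind> f) = fps_const (1 / real (card A)) * (\<Sum>x\<in>A. pgf (f x))"
  using assms by (intro fps_ext) (simp add: pgf_def pmf_bind_pmf_of_set fps_sum_nth)

text \<open>The recursion that determines the generating functions $P_n(t)$.\<close>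

lemma pgf_quicksort_swaps_le_1:
  assumes "n \<le> 1"
  shows "pgf (quicksort_swaps n) = 1"
proof -
  have "swaps_list xs = return_pmf 0" if "xs \<in> set_pmf (pmf_of_set (permutations_of_set {1..n}))" for xs
    using that assms by (subst swaps_list.simps) (auto simp: length_finite_permutations_of_set)
  then have "quicksort_swaps n = return_pmf 0"
    unfolding quicksort_swaps_def by (subst bind_pmf_cong[OF refl]) (auto simp: bind_pmf_const)
  then show ?thesis
    by (intro fps_ext) (simp add: pgf_def)
qed

lemma pgf_quicksort_swaps:
  assumes "n \<ge> 2"
  shows "pgf (quicksort_swaps n) =
    fps_const (1 / real n ^ 2) *
      (\<Sum>k=1..n. \<Sum>i=1..n.
        pgf (quicksort_swaps (k - 1)) * pgf (quicksort_swaps (n - k)) * pgf (Q_pmf n k i))"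
proof -
  have conv: "pgf (do {c \<leftarrow> p; a \<leftarrow> q; b \<leftarrow> r; return_pmf (c + a + b)}) = pgf q * pgf r * pgf p" for p q r
  proof -
    have "do {c \<leftarrow> p; a \<leftarrow> q; b \<leftarrow> r; return_pmf (c + a + b)} =
      do {c \<leftarrow> p; d \<leftarrow> do {a \<leftarrow> q; b \<leftarrow> r; return_pmf (a + b)}; return_pmf (c + d)}"
      by (simp add: bind_assoc_pmf bind_return_pmf add.assoc)
    then show ?thesis
      by (simp add: pgf_add mult_ac)
  qed
  have ne: "{..<n} \<noteq> {}" "{1..n} \<noteq> {}" using assms by (auto simp: lessThan_empty_iff)
  have "pgf (quicksort_swaps n) = fps_const (1 / real n ^ 2) * (\<Sum>i<n. \<Sum>k=1..n.
      pgf (quicksort_swaps (k - 1)) * pgf (quicksort_swaps (n - k)) * pgf (Q_pmf n k (Suc i)))"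
    unfolding quicksort_swaps_rec[OF assms]
    by (simp add: pgf_bind_pmf_of_set ne conv sum_distrib_left[symmetric] mult.assoc[symmetric]
        power2_eq_square)
  also have "(\<Sum>i<n. \<Sum>k=1..n.
      pgf (quicksort_swaps (k - 1)) * pgf (quicksort_swaps (n - k)) * pgf (Q_pmf n k (Suc i))) =
    (\<Sum>i=1..n. \<Sum>k=1..n.
      pgf (quicksort_swaps (k - 1)) * pgf (quicksort_swaps (n - k)) * pgf (Q_pmf n k i))"
    by (rule sum.reindex_bij_witness[of _ "\<lambda>i. i - 1" Suc]) auto
  also have "\<dots> = (\<Sum>k=1..n. \<Sum>i=1..n.
      pgf (quicksort_swaps (k - 1)) * pgf (quicksort_swaps (n - k)) * pgf (Q_pmf n k i))"
    by (rule sum.swap)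
  finally show ?thesis .
qed

end

theory Submission
  imports Defs
begin

text \<open>
  The central moment is a polynomial in the binomial moments $B_r(n) = E\binom{X_n}{r}$ with
  $r \le 3$, and binomial moments suit this problem because the moments of a sum of independent
  variables are convolutions of the moments of the summands.

  \<^bold>\<open>Partitioning.\<close> Suppose that the pivot has rank \<open>k\<close>, so that there are $p = n - k$ larger and
  $q = k - 1$ smaller elements. Averaged over the position of the pivot, the list is a uniformly
  random permutation. A choice of \<open>a\<close> larger and \<open>b\<close> smaller elements is then misplaced as a whole
  with probability $a!\,b!/(a+b+1)!$: the chosen larger ones must precede the pivot and the chosen
  smaller ones must follow it. Hence the \<open>r\<close>-th binomial moment of the number of swaps is
  $\sum_{a+b=r} \frac{a!\,b!}{(r+1)!}\binom pa\binom qb$ (\<open>Q_pmf_moments\<close>).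

  \<^bold>\<open>Generating functions.\<close> The factors $\binom pa$ and $\binom qb$ act on one sublist each, so the
  recursion for $B_r(n)$ turns into the differential equation \<open>fps_deriv_moment_fps\<close> for
  $G_r(z) = \sum_n B_r(n) z^n$, in which weighting by $\binom na$ is the operator $z^a D^a/a!$. Its
  only terms with $G_r$ are $2 G_0 G_r$, where $G_0 = u = 1/(1-z)$, so it is linear and of first
  order; multiplication by $(1-z)^2$ shows that the solution is unique (\<open>linear_ode_unique\<close>).

  \<^bold>\<open>Solution.\<close> Let $L = -\log(1-z)$. Then $u' = u^2$, $L' = u$ and $zu = u - 1$, so that the
  polynomials in \<open>u\<close> and \<open>L\<close> that have a factor \<open>u\<close> are mapped to themselves by each $z^a D^a$. The
  equations for $G_1$, $G_2$, $G_3$ can be solved among them, and checking the solutions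
  \<open>moment_fps_1\<close>, \<open>moment_fps_2\<close>, \<open>moment_fps_3\<close> is an identity between polynomials.

  \<^bold>\<open>Coefficients.\<close> Applying $z D$ to $u^b L^a$ yields a recursion in \<open>b\<close> at fixed \<open>n\<close>, which reduces
  the coefficients of $u^b L^a$ to those of $u L^a$; these are $H_1$, $H_1^2 - H_2$ and
  $H_1^3 - 3 H_1 H_2 + 2 H_3$. In the third central moment the powers of $H_1$ beyond the first
  cancel, as do its products with $H_2$.
\<close>

section \<open>Swaps of one partitioning step\<close>

text \<open>
  The number of swaps in terms of the value of the pivot instead of its position. This form
  satisfies a recursion on the list, and it makes sense for a permutation without a
  distinguished position.
\<close>

definition out_of_place :: "'a::linorder \<Rightarrow> 'a list \<Rightarrow> nat" where
  "out_of_place k xs =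
     length (filter (\<lambda>x. x > k) (takeWhile (\<lambda>x. x \<noteq> k) xs)) +
     length (filter (\<lambda>x. x < k) (dropWhile (\<lambda>x. x \<noteq> k) xs))"

lemma out_of_place_Cons:
  "out_of_place k (x # xs) =
     (if x = k then length (filter (\<lambda>y. y < k) xs)
      else (if x > k then 1 else 0) + out_of_place k xs)"
  by (cases "x = k") (auto simp add: out_of_place_def)

lemma misplaced_eq_out_of_place:
  assumes "distinct xs" "i < length xs"
  shows "misplaced i xs = out_of_place (xs ! i) xs"
proof -
  have eq: "xs = take i xs @ xs ! i # drop (Suc i) xs"
    using assms(2) by (rule id_take_nth_drop)
  have "distinct (take i xs @ xs ! i # drop (Suc i) xs)"
    using assms(1) eq by simp
  then have ni: "\<forall>x\<in>set (take i xs). x \<noteq> xs ! i"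
    by auto
  have "takeWhile (\<lambda>x. x \<noteq> xs ! i) (take i xs @ xs ! i # drop (Suc i) xs) = take i xs"
    using ni by (simp add: takeWhile_append2)
  moreover have "dropWhile (\<lambda>x. x \<noteq> xs ! i) (take i xs @ xs ! i # drop (Suc i) xs) =
      xs ! i # drop (Suc i) xs"
    using ni by (simp add: dropWhile_append2)
  ultimately show ?thesis
    by (simp add: misplaced_def out_of_place_def flip: eq)
qed

text \<open>
  With \<open>p\<close> elements larger and \<open>q\<close> elements smaller than the pivot, a choice of \<open>a\<close> larger and
  \<open>b\<close> smaller elements is misplaced as a whole if all the larger ones come before the pivot and
  all the smaller ones after it. This determines the place of the pivot among the $a + b + 1$
  elements, and $a!\,b!$ of their $(a + b + 1)!$ orders remain.
\<close>

definition partition_moment :: "nat \<Rightarrow> nat \<Rightarrow> nat \<Rightarrow> real" where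
  "partition_moment p q r =
     (\<Sum>a\<le>r. fact a * fact (r - a) / fact (Suc r) * real (p choose a) * real (q choose (r - a)))"

text \<open>
  The three summands correspond to a random list that begins with the pivot, with a larger element
  or with a smaller element. Multiplication by \<open>p\<close> or \<open>q\<close> turns each factor with a lowered upper
  index back into one with upper index \<open>p\<close> or \<open>q\<close>, and the scalars then add up to $p + q + 1$.
\<close>

lemma partition_moment_rec:
  "real (p + q + 1) * partition_moment p q r =
     real (q choose r)
     + real p * (partition_moment (p - 1) q r + (if r = 0 then 0 else partition_moment (p - 1) q (r - 1)))
     + real q * partition_moment p (q - 1) r"
proof -
  define T where "T = (\<lambda>a b. fact a * fact b * real (p choose a) * real (q choose b))"
  define S where "S = (\<Sum>a\<le>r. T a (r - a))"
  have comp: "real m * real ((m - 1) choose a) = (real m - real a) * real (m choose a)" for m a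
  proof (cases "a \<le> m")
    case True
    have "real m * real ((m - 1) choose a) = real ((m - a) * (m choose a))"
      by (simp only: binomial_absorb_comp of_nat_mult)
    then show ?thesis using True by (simp add: of_nat_diff)
  next
    case False
    then show ?thesis by (simp add: binomial_eq_0)
  qed
  have main: "partition_moment p q r = S / fact (Suc r)"
    unfolding partition_moment_def S_def T_def sum_divide_distrib
    by (intro sum.cong) (auto simp: field_simps)
  have left: "real p * partition_moment (p - 1) q r
      = (\<Sum>a\<le>r. (real p - real a) * T a (r - a)) / fact (Suc r)"
    unfolding partition_moment_def T_def sum_distrib_left sum_divide_distrib
  proof (intro sum.cong refl)
    fix a
    have "real p * (fact a * fact (r - a) / fact (Suc r) * real (p - 1 choose a) * real (q choose (r - a)))
       = fact a * fact (r - a) / fact (Suc r) * (real p * real (p - 1 choose a)) * real (q choose (r - a))"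
      by (simp only: mult_ac)
    then show "real p * (fact a * fact (r - a) / fact (Suc r) * real (p - 1 choose a) * real (q choose (r - a)))
       = (real p - real a) * (fact a * fact (r - a) * real (p choose a) * real (q choose (r - a))) / fact (Suc r)"
      unfolding comp by (simp add: mult_ac)
  qed
  have right: "real q * partition_moment p (q - 1) r
      = (\<Sum>a\<le>r. (real q - real (r - a)) * T a (r - a)) / fact (Suc r)"
    unfolding partition_moment_def T_def sum_distrib_left sum_divide_distrib
  proof (intro sum.cong refl)
    fix a
    have "real q * (fact a * fact (r - a) / fact (Suc r) * real (p choose a) * real (q - 1 choose (r - a)))
       = fact a * fact (r - a) / fact (Suc r) * real (p choose a) * (real q * real (q - 1 choose (r - a)))"
      by (simp only: mult_ac)
    then show "real q * (fact a * fact (r - a) / fact (Suc r) * real (p choose a) * real (q - 1 choose (r - a)))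
       = (real q - real (r - a)) * (fact a * fact (r - a) * real (p choose a) * real (q choose (r - a))) / fact (Suc r)"
      unfolding comp by (simp add: mult_ac)
  qed
  have low: "real (q choose r) + (if r = 0 then 0 else real p * partition_moment (p - 1) q (r - 1))
      = S / fact r"
  proof (cases r)
    case 0
    then show ?thesis by (simp add: S_def T_def)
  next
    case (Suc s)
    have "real p * partition_moment (p - 1) q s = (\<Sum>a\<le>s. T (Suc a) (s - a)) / fact (Suc s)"
      unfolding partition_moment_def T_def sum_distrib_left sum_divide_distrib
    proof (intro sum.cong refl)
      fix a
      have "real p * real (p - 1 choose a) = real (Suc a) * real (p choose Suc a)"
        by (simp only: flip: binomial_absorption of_nat_mult)
      then show "real p * (fact a * fact (s - a) / fact (Suc s) * real (p - 1 choose a) * real (q choose (s - a)))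
         = fact (Suc a) * fact (s - a) * real (p choose Suc a) * real (q choose (s - a)) / fact (Suc s)"
        by (simp add: mult_ac)
    qed
    moreover have "S = T 0 (Suc s) + (\<Sum>a\<le>s. T (Suc a) (s - a))"
      unfolding S_def Suc by (subst sum.atMost_Suc_shift) simp
    ultimately show ?thesis
      using Suc by (simp add: T_def add_divide_distrib)
  qed
  (* The elements already chosen number a + (r - a) = r, which leaves p + q - r. *)
  have "(\<Sum>a\<le>r. (real p - real a) * T a (r - a)) + (\<Sum>a\<le>r. (real q - real (r - a)) * T a (r - a))
     = (real p + real q - real r) * S"
    unfolding S_def sum_distrib_left sum.distrib[symmetric]
    by (intro sum.cong) (auto simp: algebra_simps of_nat_diff)
  then have "real p * partition_moment (p - 1) q r + real q * partition_moment p (q - 1) r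
     = (real p + real q - real r) * S / fact (Suc r)"
    unfolding left right by (simp only: add_divide_distrib [symmetric])
  moreover have "S / fact r = (real r + 1) * S / fact (Suc r)"
    by (simp add: divide_eq_eq eq_divide_eq add_nonneg_eq_0_iff)
  ultimately have "real p * partition_moment (p - 1) q r + real q * partition_moment p (q - 1) r
      + S / fact r = real (p + q + 1) * (S / fact (Suc r))"
    by (simp add: add_divide_distrib [symmetric] distrib_right [symmetric] del: fact_Suc)
  then show ?thesis
    unfolding low [symmetric] main by (cases "r = 0") (simp_all add: algebra_simps del: fact_Suc)
qed

lemma partition_moment_0_0: "partition_moment 0 0 r = (if r = 0 then 1 else 0)"
  using partition_moment_rec[of 0 0 r] by (cases r) auto

lemma sum_permutations_of_set:
  fixes g :: "'a list \<Rightarrow> 'b::comm_monoid_add"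
  assumes "finite A" "A \<noteq> {}"
  shows "(\<Sum>xs\<in>permutations_of_set A. g xs) =
    (\<Sum>x\<in>A. \<Sum>ys\<in>permutations_of_set (A - {x}). g (x # ys))"
proof -
  have "(\<Sum>xs\<in>permutations_of_set A. g xs) =
      (\<Sum>x\<in>A. sum g ((#) x ` permutations_of_set (A - {x})))"
    unfolding permutations_of_set_nonempty[OF assms(2)]
    using assms(1) by (intro sum.UNION_disjoint) auto
  then show ?thesis
    by (simp add: sum.reindex)
qed

lemma choose_Suc_left: "real (Suc m choose r) = real (m choose r) + (if r = 0 then 0 else real (m choose (r - 1)))"
  by (cases r) simp_all

text \<open>
  Removing the first element of a permutation gives an induction on the size of the set. If the
  first element is the pivot, all smaller elements are misplaced; if it is larger than the pivot,
  it is itself misplaced; if it is smaller, nothing changes.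
\<close>

lemma sum_out_of_place_choose:
  fixes A :: "'a::linorder set"
  assumes "finite A" "k \<in> A"
  shows "(\<Sum>xs\<in>permutations_of_set A. real (out_of_place k xs choose r)) =
    fact (card A) * partition_moment (card {x \<in> A. x > k}) (card {x \<in> A. x < k}) r"
  using assms
proof (induction "card A" arbitrary: A r)
  case 0
  then show ?case by auto
next
  case (Suc m A r)
  define U where "U = {x \<in> A. x > k}"
  define L where "L = {x \<in> A. x < k}"
  define p where "p = card U"
  define q where "q = card L"
  have fin: "finite U" "finite L" and A: "A = insert k (U \<union> L)"
    and disj: "U \<inter> L = {}" "k \<notin> U \<union> L"
    using Suc.prems by (auto simp: U_def L_def)
  have m: "m = p + q"
    using Suc.hyps(2) fin disj unfolding A p_def q_def by (simp add: card_Un_disjoint)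
  let ?f = "\<lambda>x. \<Sum>ys\<in>permutations_of_set (A - {x}). real (out_of_place k (x # ys) choose r)"
  have card': "card (A - {x}) = m" "finite (A - {x})" if "x \<in> A" for x
    using Suc.hyps(2) Suc.prems that by auto
  have fk: "?f k = fact m * real (q choose r)"
  proof -
    have "length (filter (\<lambda>y. y < k) ys) = q" if "ys \<in> permutations_of_set (A - {k})" for ys
    proof -
      have "length (filter (\<lambda>y. y < k) ys) = card (set (filter (\<lambda>y. y < k) ys))"
        using that by (intro distinct_card[symmetric]) (auto dest: permutations_of_setD)
      also have "set (filter (\<lambda>y. y < k) ys) = L"
        using that by (auto simp: L_def dest: permutations_of_setD)
      finally show ?thesis by (simp add: q_def)
    qed
    then have "?f k = (\<Sum>ys\<in>permutations_of_set (A - {k}). real (q choose r))"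
      by (intro sum.cong) (auto simp: out_of_place_Cons)
    then show ?thesis
      using card'[OF Suc.prems(2)] by simp
  qed
  have fU: "?f x = fact m * (partition_moment (p - 1) q r +
      (if r = 0 then 0 else partition_moment (p - 1) q (r - 1)))" if x: "x \<in> U" for x
  proof -
    have xA: "x \<in> A" "k \<in> A - {x}" "k < x" "x \<noteq> k" using x Suc.prems by (auto simp: U_def)
    have "{y \<in> A - {x}. k < y} = U - {x}" "{y \<in> A - {x}. y < k} = L"
      using x by (auto simp: U_def L_def)
    then have IH: "(\<Sum>ys\<in>permutations_of_set (A - {x}). real (out_of_place k ys choose r)) =
        fact m * partition_moment (p - 1) q r" for r
      using Suc.hyps(1)[of "A - {x}" r] card'[OF xA(1)] xA x fin by (simp add: p_def q_def)
    have "?f x = (\<Sum>ys\<in>permutations_of_set (A - {x}). real (out_of_place k ys choose r)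
        + (if r = 0 then 0 else real (out_of_place k ys choose (r - 1))))"
      using xA by (intro sum.cong refl) (simp add: out_of_place_Cons choose_Suc_left)
    then show ?thesis
      using IH[of r] by (cases "r = 0") (simp_all add: sum.distrib IH distrib_left)
  qed
  have fL: "?f x = fact m * partition_moment p (q - 1) r" if x: "x \<in> L" for x
  proof -
    have xA: "x \<in> A" "k \<in> A - {x}" "x < k" "x \<noteq> k" "\<not> k < x"
      using x Suc.prems by (auto simp: L_def)
    have "{y \<in> A - {x}. k < y} = U" "{y \<in> A - {x}. y < k} = L - {x}"
      using x by (auto simp: U_def L_def)
    then show ?thesis
      using Suc.hyps(1)[of "A - {x}" r] card'[OF xA(1)] xA x fin
      by (simp add: p_def q_def out_of_place_Cons)
  qed
  have "(\<Sum>xs\<in>permutations_of_set A. real (out_of_place k xs choose r)) = (\<Sum>x\<in>A. ?f x)"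
    using Suc.prems by (intro sum_permutations_of_set) auto
  also have "\<dots> = ?f k + ((\<Sum>x\<in>U. ?f x) + (\<Sum>x\<in>L. ?f x))"
  proof -
    have "sum h A = h k + (sum h U + sum h L)" for h :: "'a \<Rightarrow> real"
      using fin disj unfolding A by (simp add: sum.union_disjoint)
    then show ?thesis .
  qed
  also have "\<dots> = fact m * (real (q choose r)
     + real p * (partition_moment (p - 1) q r + (if r = 0 then 0 else partition_moment (p - 1) q (r - 1)))
     + real q * partition_moment p (q - 1) r)"
    using fU fL by (simp add: fk p_def q_def algebra_simps)
  also have "\<dots> = fact m * (real (p + q + 1) * partition_moment p q r)"
    by (subst partition_moment_rec) (rule refl)
  also have "\<dots> = fact (Suc m) * partition_moment p q r"
    using m by simp
  finally show ?case
    unfolding Suc.hyps(2) p_def q_def U_def L_def by simp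
qed

lemma card_perms_at:
  assumes "k \<in> {1..n}" "i < n"
  shows "card (perms_at n k i) = fact (n - 1)"
proof -
  have "card (permutations_of_set {1..n}) = (\<Sum>j\<in>{1..n}. card (perms_at n j i))"
  proof -
    have "permutations_of_set {1..n} = (\<Union>j\<in>{1..n}. perms_at n j i)"
    proof (intro equalityI subsetI)
      fix xs assume xs: "xs \<in> permutations_of_set {1..n}"
      then have "xs ! i \<in> {1..n}"
        using assms(2) length_finite_permutations_of_set[OF xs]
        by (metis card_atLeastAtMost diff_Suc_1 nth_mem permutations_of_setD(1))
      then show "xs \<in> (\<Union>j\<in>{1..n}. perms_at n j i)"
        using xs by (auto simp: perms_at_def)
    qed (auto simp: perms_at_def)
    then show ?thesis
      by (simp only:) (subst card_UN_disjoint, auto simp: finite_perms_at, auto simp: perms_at_def)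
  qed
  also have "\<dots> = (\<Sum>j\<in>{1..n}. card (perms_at n k i))"
  proof (rule sum.cong[OF refl])
    fix j assume "j \<in> {1..n}"
    then have "Transposition.transpose k j permutes {1..n}"
      using assms by (intro permutes_swap_id) auto
    from bij_betw_map_perms_at[OF this assms(2), of k]
    show "card (perms_at n j i) = card (perms_at n k i)"
      by (simp add: bij_betw_same_card)
  qed
  finally show ?thesis
    using assms by (simp add: fact_reduce[of n])
qed

text \<open>
  For fixed \<open>i\<close> the moments are those of a shifted hypergeometric distribution. Only their sum
  over \<open>i\<close> is needed, and it is simpler: the permutations with value \<open>k\<close> at some position \<open>i\<close> are
  all permutations, and each \<open>i\<close> contributes the same number of them.
\<close>

lemma Q_pmf_moments:
  assumes k: "k \<in> {1..n}"
  shows "(\<Sum>i<n. measure_pmf.expectation (Q_pmf n k (Suc i)) (\<lambda>x. real (x choose r))) =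
    real n * partition_moment (n - k) (k - 1) r"
proof -
  have "(\<Sum>i<n. measure_pmf.expectation (Q_pmf n k (Suc i)) (\<lambda>x. real (x choose r))) =
      (\<Sum>i<n. (\<Sum>xs\<in>perms_at n k i. real (out_of_place k xs choose r)) / fact (n - 1))"
  proof (rule sum.cong[OF refl])
    fix i assume "i \<in> {..<n}"
    then have i: "i < n" by simp
    have "misplaced i xs = out_of_place k xs" if "xs \<in> perms_at n k i" for xs
      using misplaced_eq_out_of_place[of xs i] perms_atD[OF that] i by simp
    then show "measure_pmf.expectation (Q_pmf n k (Suc i)) (\<lambda>x. real (x choose r)) =
        (\<Sum>xs\<in>perms_at n k i. real (out_of_place k xs choose r)) / fact (n - 1)"
      using perms_at_nonempty[OF k i] finite_perms_at
      by (simp add: Q_pmf_eq[OF k i] integral_pmf_of_set card_perms_at[OF k i])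
  qed
  also have "\<dots> = (\<Sum>xs\<in>(\<Union>i<n. perms_at n k i). real (out_of_place k xs choose r)) / fact (n - 1)"
  proof -
    have "(\<Sum>xs\<in>(\<Union>i<n. perms_at n k i). real (out_of_place k xs choose r)) =
      (\<Sum>i<n. \<Sum>xs\<in>perms_at n k i. real (out_of_place k xs choose r))"
    proof (rule sum.UNION_disjoint)
      show "\<forall>i\<in>{..<n}. \<forall>j\<in>{..<n}. i \<noteq> j \<longrightarrow> perms_at n k i \<inter> perms_at n k j = {}"
      proof safe
        fix i j xs assume ij: "i < n" "j < n" "i \<noteq> j" and xs: "xs \<in> perms_at n k i" "xs \<in> perms_at n k j"
        then show "xs \<in> {}"
          using nth_eq_iff_index_eq[of xs i j] perms_atD[OF xs(1)] perms_atD[OF xs(2)] by simp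
      qed
    qed (auto simp: finite_perms_at)
    then show ?thesis by (simp add: sum_divide_distrib)
  qed
  also have "(\<Union>i<n. perms_at n k i) = permutations_of_set {1..n}"
  proof (intro equalityI subsetI)
    fix xs assume xs: "xs \<in> permutations_of_set {1..n}"
    then have "length xs = n" "k \<in> set xs"
      using k length_finite_permutations_of_set[OF xs] by (auto dest: permutations_of_setD)
    then obtain i where "i < n" "xs ! i = k"
      by (auto simp: in_set_conv_nth)
    then show "xs \<in> (\<Union>i<n. perms_at n k i)"
      using xs by (auto simp: perms_at_def)
  qed (auto simp: perms_at_def)
  also have "(\<Sum>xs\<in>permutations_of_set {1..n}. real (out_of_place k xs choose r)) =
      fact n * partition_moment (card {x \<in> {1..n}. x > k}) (card {x \<in> {1..n}. x < k}) r"
    using k by (subst sum_out_of_place_choose) auto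
  also have "{x \<in> {1..n}. x > k} = {k<..n}" using k by auto
  also have "{x \<in> {1..n}. x < k} = {1..<k}" using k by auto
  finally show ?thesis
    using k by (simp add: fact_reduce[of n])
qed

section \<open>Recursion for the binomial moments\<close>

definition binomial_moment :: "nat pmf \<Rightarrow> nat \<Rightarrow> real" where
  "binomial_moment p r = measure_pmf.expectation p (\<lambda>x. real (x choose r))"

lemma expectation_bind_finite:
  fixes h :: "'b \<Rightarrow> real"
  assumes "finite (set_pmf p)" "\<And>a. a \<in> set_pmf p \<Longrightarrow> finite (set_pmf (f a))"
  shows "measure_pmf.expectation (p \<bind> f) h =
    measure_pmf.expectation p (\<lambda>a. measure_pmf.expectation (f a) h)"
proof -
  have "measure_pmf.expectation (p \<bind> f) h =
      (\<Sum>a\<in>set_pmf p. pmf p a *\<^sub>R measure_pmf.expectation (f a) h)"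
    using assms by (intro pmf_expectation_bind) auto
  also have "\<dots> = measure_pmf.expectation p (\<lambda>a. measure_pmf.expectation (f a) h)"
    using assms(1) by (intro integral_measure_pmf [symmetric]) auto
  finally show ?thesis .
qed

text \<open>Vandermonde's identity, together with independence.\<close>

lemma binomial_moment_add:
  assumes fin: "finite (set_pmf p)" "finite (set_pmf q)"
  shows "binomial_moment (do {a \<leftarrow> p; b \<leftarrow> q; return_pmf (a + b)}) r =
    (\<Sum>j\<le>r. binomial_moment p j * binomial_moment q (r - j))"
proof -
  have "measure_pmf.expectation (q \<bind> (\<lambda>b. return_pmf (a + b))) (\<lambda>x. real (x choose r)) =
      (\<Sum>j\<le>r. real (a choose j) * binomial_moment q (r - j))" for a
  proof -
    have "measure_pmf.expectation (q \<bind> (\<lambda>b. return_pmf (a + b))) (\<lambda>x. real (x choose r)) =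
        measure_pmf.expectation q (\<lambda>b. \<Sum>j\<le>r. real (a choose j) * real (b choose (r - j)))"
      using fin by (simp add: expectation_bind_finite vandermonde [symmetric])
    also have "\<dots> = (\<Sum>j\<le>r. measure_pmf.expectation q (\<lambda>b. real (a choose j) * real (b choose (r - j))))"
      using fin by (intro Bochner_Integration.integral_sum integrable_measure_pmf_finite)
    finally show ?thesis by (simp add: binomial_moment_def)
  qed
  then have "binomial_moment (do {a \<leftarrow> p; b \<leftarrow> q; return_pmf (a + b)}) r =
      measure_pmf.expectation p (\<lambda>a. \<Sum>j\<le>r. real (a choose j) * binomial_moment q (r - j))"
    using fin by (simp add: binomial_moment_def expectation_bind_finite)
  also have "\<dots> = (\<Sum>j\<le>r. measure_pmf.expectation p (\<lambda>a. real (a choose j) * binomial_moment q (r - j)))"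
    using fin by (intro Bochner_Integration.integral_sum integrable_measure_pmf_finite)
  finally show ?thesis by (simp add: binomial_moment_def)
qed

lemma binomial_moment_bind_pmf_of_set:
  assumes "A \<noteq> {}" "finite A" "\<And>x. x \<in> A \<Longrightarrow> finite (set_pmf (f x))"
  shows "binomial_moment (pmf_of_set A \<bind> f) r = (\<Sum>x\<in>A. binomial_moment (f x) r) / real (card A)"
  unfolding binomial_moment_def using assms
  by (subst pmf_expectation_bind_pmf_of_set)
    (simp_all add: sum_divide_distrib sum_distrib_left divide_inverse mult.commute)

lemma finite_swaps_list: "finite (set_pmf (swaps_list xs))"
proof (induction xs rule: swaps_list.induct)
  case (1 xs)
  show ?case
  proof (cases "length xs \<le> 1")
    case True
    then show ?thesis by (simp add: swaps_list.simps)
  next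
    case False
    then have "set_pmf (pmf_of_set {..<length xs}) = {..<length xs}"
      by (intro set_pmf_of_set) (auto simp: lessThan_empty_iff)
    with False 1 show ?thesis
      by (subst swaps_list.simps) (auto simp: set_pmf_not_empty)
  qed
qed

lemma finite_quicksort_swaps: "finite (set_pmf (quicksort_swaps n))"
  by (simp add: quicksort_swaps_def finite_swaps_list)

lemma finite_Q_pmf:
  assumes "k \<in> {1..n}" "i < n"
  shows "finite (set_pmf (Q_pmf n k (Suc i)))"
  using perms_at_nonempty[OF assms] by (simp add: Q_pmf_eq[OF assms] finite_perms_at)

lemma binomial_moment_quicksort_swaps_le_1:
  assumes "n \<le> 1"
  shows "binomial_moment (quicksort_swaps n) r = (if r = 0 then 1 else 0)"
proof -
  have "pmf (quicksort_swaps n) m = pmf (return_pmf 0) m" for m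
    using arg_cong[OF pgf_quicksort_swaps_le_1[OF assms], of "\<lambda>f. fps_nth f m"]
    by (simp add: pgf_def indicator_def)
  then have "quicksort_swaps n = return_pmf 0"
    by (intro pmf_eqI)
  then show ?thesis
    by (cases r) (simp_all add: binomial_moment_def)
qed

text \<open>
  Since the two sublists do not depend on \<open>i\<close>, summation over the positions affects only the
  partitioning step. A list of length 1 satisfies the same equation, so that no exceptional case
  is left for the generating functions.
\<close>

lemma binomial_moment_quicksort_swaps_rec:
  assumes "n \<ge> 1"
  shows "real n * binomial_moment (quicksort_swaps n) r =
    (\<Sum>k=1..n. \<Sum>m\<le>r. partition_moment (n - k) (k - 1) m *
      (\<Sum>x\<le>r - m. binomial_moment (quicksort_swaps (k - 1)) x *
                  binomial_moment (quicksort_swaps (n - k)) (r - m - x)))"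
proof (cases "n = 1")
  case True
  have "(\<Sum>m\<le>r. partition_moment 0 0 m *
      (\<Sum>x\<le>r - m. binomial_moment (quicksort_swaps 0) x * binomial_moment (quicksort_swaps 0) (r - m - x)))
    = (\<Sum>m\<le>r. if m = 0 then (if r = 0 then 1 else 0) else 0)"
  proof (rule sum.cong[OF refl])
    fix m
    have "(\<Sum>x\<le>r. binomial_moment (quicksort_swaps 0) x * binomial_moment (quicksort_swaps 0) (r - x)) =
      (\<Sum>x\<le>r. if x = 0 then (if r = 0 then 1 else 0) else 0)"
      by (intro sum.cong) (auto simp: binomial_moment_quicksort_swaps_le_1)
    then show "partition_moment 0 0 m *
      (\<Sum>x\<le>r - m. binomial_moment (quicksort_swaps 0) x * binomial_moment (quicksort_swaps 0) (r - m - x))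
      = (if m = 0 then (if r = 0 then 1 else 0) else 0)"
      by (simp add: partition_moment_0_0)
  qed
  then show ?thesis
    using True by (simp add: binomial_moment_quicksort_swaps_le_1)
next
  case False
  then have n: "n \<ge> 2" using assms by simp
  define M where "M k = do {a \<leftarrow> quicksort_swaps (k - 1); b \<leftarrow> quicksort_swaps (n - k); return_pmf (a + b)}" for k
  have M: "binomial_moment (M k) s = (\<Sum>x\<le>s. binomial_moment (quicksort_swaps (k - 1)) x *
                  binomial_moment (quicksort_swaps (n - k)) (s - x))" for k s
    unfolding M_def by (intro binomial_moment_add finite_quicksort_swaps)
  have finM: "finite (set_pmf (M k))" for k
    by (simp add: M_def finite_quicksort_swaps)
  have rec: "quicksort_swaps n = do {i \<leftarrow> pmf_of_set {..<n}; k \<leftarrow> pmf_of_set {1..n};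
      c \<leftarrow> Q_pmf n k (Suc i); d \<leftarrow> M k; return_pmf (c + d)}"
    unfolding quicksort_swaps_rec[OF n] M_def
    by (simp add: bind_assoc_pmf bind_return_pmf add.assoc)
  have ne: "{..<n} \<noteq> {}" "{1..n} \<noteq> {}" using n by (auto simp: lessThan_empty_iff)
  have "binomial_moment (quicksort_swaps n) r = (\<Sum>i<n. \<Sum>k=1..n. \<Sum>m\<le>r.
      binomial_moment (Q_pmf n k (Suc i)) m * binomial_moment (M k) (r - m)) / real n ^ 2"
  proof -
    let ?N = "\<lambda>i. do {k \<leftarrow> pmf_of_set {1..n}; c \<leftarrow> Q_pmf n k (Suc i); d \<leftarrow> M k; return_pmf (c + d)}"
    have finN: "finite (set_pmf (?N i))" if "i < n" for i
      using finM finite_Q_pmf that by (auto simp: set_pmf_of_set ne)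
    have "binomial_moment (?N i) r = (\<Sum>k=1..n. \<Sum>m\<le>r.
        binomial_moment (Q_pmf n k (Suc i)) m * binomial_moment (M k) (r - m)) / real n"
      if i: "i < n" for i
    proof -
      have "binomial_moment (?N i) r =
          (\<Sum>k=1..n. binomial_moment (do {c \<leftarrow> Q_pmf n k (Suc i); d \<leftarrow> M k; return_pmf (c + d)}) r)
            / real (card {1..n})"
        using finM finite_Q_pmf i ne by (intro binomial_moment_bind_pmf_of_set) auto
      also have "(\<Sum>k=1..n. binomial_moment (do {c \<leftarrow> Q_pmf n k (Suc i); d \<leftarrow> M k; return_pmf (c + d)}) r) =
          (\<Sum>k=1..n. \<Sum>m\<le>r. binomial_moment (Q_pmf n k (Suc i)) m * binomial_moment (M k) (r - m))"
        using finM finite_Q_pmf i by (intro sum.cong refl binomial_moment_add) auto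
      finally show ?thesis by simp
    qed
    moreover have "binomial_moment (quicksort_swaps n) r =
        (\<Sum>i<n. binomial_moment (?N i) r) / real (card {..<n})"
      unfolding rec using finN ne by (intro binomial_moment_bind_pmf_of_set) auto
    ultimately show ?thesis
      by (simp add: power2_eq_square sum_divide_distrib)
  qed
  also have "(\<Sum>i<n. \<Sum>k=1..n. \<Sum>m\<le>r.
      binomial_moment (Q_pmf n k (Suc i)) m * binomial_moment (M k) (r - m)) =
    (\<Sum>k=1..n. \<Sum>m\<le>r. (\<Sum>i<n. binomial_moment (Q_pmf n k (Suc i)) m) * binomial_moment (M k) (r - m))"
    unfolding sum_distrib_right by (subst sum.swap, rule sum.cong[OF refl], rule sum.swap)
  also have "\<dots> = (\<Sum>k=1..n. \<Sum>m\<le>r. real n * (partition_moment (n - k) (k - 1) m * binomial_moment (M k) (r - m)))"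
    by (intro sum.cong refl) (subst Q_pmf_moments [folded binomial_moment_def], auto)
  also have "\<dots> = real n * (\<Sum>k=1..n. \<Sum>m\<le>r. partition_moment (n - k) (k - 1) m * binomial_moment (M k) (r - m))"
    by (simp add: sum_distrib_left)
  finally show ?thesis
    using n by (simp add: M power2_eq_square)
qed

section \<open>Differential equations for the moment generating functions\<close>

definition moment_fps :: "nat \<Rightarrow> real fps" where
  "moment_fps r = Abs_fps (\<lambda>n. binomial_moment (quicksort_swaps n) r)"

text \<open>The operator $z^a D^a / a!$, where \<open>D\<close> is the derivative.\<close>

definition choose_weight :: "nat \<Rightarrow> real fps \<Rightarrow> real fps" where
  "choose_weight a F = Abs_fps (\<lambda>n. real (n choose a) * fps_nth F n)"

text \<open>
  The summand with indices \<open>m\<close>, \<open>x\<close>, \<open>a\<close> stands for \<open>m\<close> swaps chosen in the partitioning step, \<open>a\<close>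
  of which move a larger element, and for \<open>x\<close> swaps chosen in the sublist of smaller elements.
  Moving \<open>a\<close> larger elements contributes a factor $\binom{n-k}{a}$, which depends only on the length
  of the other sublist, so the sum over \<open>k\<close> is a Cauchy product.
\<close>

lemma fps_deriv_moment_fps:
  "fps_deriv (moment_fps r) =
     (\<Sum>m\<le>r. \<Sum>x\<le>r - m. \<Sum>a\<le>m. fps_const (fact a * fact (m - a) / fact (Suc m)) *
        (choose_weight (m - a) (moment_fps x) * choose_weight a (moment_fps (r - m - x))))"
proof (rule fps_ext)
  fix n
  have "fps_nth (fps_deriv (moment_fps r)) n =
     (\<Sum>k=1..Suc n. \<Sum>m\<le>r. partition_moment (Suc n - k) (k - 1) m *
      (\<Sum>x\<le>r - m. binomial_moment (quicksort_swaps (k - 1)) x *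
                  binomial_moment (quicksort_swaps (Suc n - k)) (r - m - x)))"
    using binomial_moment_quicksort_swaps_rec[of "Suc n" r] by (simp add: moment_fps_def)
  also have "\<dots> = (\<Sum>j=0..n. \<Sum>m\<le>r. partition_moment (n - j) j m *
      (\<Sum>x\<le>r - m. binomial_moment (quicksort_swaps j) x *
                  binomial_moment (quicksort_swaps (n - j)) (r - m - x)))"
    by (rule sum.reindex_bij_witness[of _ Suc "\<lambda>k. k - 1"]) auto
  also have "\<dots> = (\<Sum>j=0..n. \<Sum>m\<le>r. \<Sum>x\<le>r - m. \<Sum>a\<le>m. fact a * fact (m - a) / fact (Suc m) *
        (fps_nth (choose_weight (m - a) (moment_fps x)) j *
         fps_nth (choose_weight a (moment_fps (r - m - x))) (n - j)))"
    unfolding partition_moment_def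
    by (intro sum.cong refl, subst mult.commute)
      (simp add: sum_product moment_fps_def choose_weight_def mult_ac del: fact_Suc)
  also have "\<dots> = (\<Sum>m\<le>r. \<Sum>x\<le>r - m. \<Sum>a\<le>m. \<Sum>j=0..n. fact a * fact (m - a) / fact (Suc m) *
        (fps_nth (choose_weight (m - a) (moment_fps x)) j *
         fps_nth (choose_weight a (moment_fps (r - m - x))) (n - j)))"
    by (subst sum.swap, rule sum.cong[OF refl], subst sum.swap, rule sum.cong[OF refl], rule sum.swap)
  finally show "fps_nth (fps_deriv (moment_fps r)) n = fps_nth (\<Sum>m\<le>r. \<Sum>x\<le>r - m. \<Sum>a\<le>m.
      fps_const (fact a * fact (m - a) / fact (Suc m)) *
        (choose_weight (m - a) (moment_fps x) * choose_weight a (moment_fps (r - m - x)))) n"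
    by (simp only: fps_sum_nth fps_mult_left_const_nth) (simp only: fps_mult_nth sum_distrib_left)
qed

lemma choose_weight_0: "choose_weight 0 F = F"
  by (intro fps_ext) (simp add: choose_weight_def)

text \<open>
  From $(a+1)\binom{n}{a+1} = (n - a)\binom na$. It allows the operators to be computed by single
  derivatives.
\<close>

lemma choose_weight_Suc:
  "of_nat (Suc a) * choose_weight (Suc a) F =
     fps_X * fps_deriv (choose_weight a F) - of_nat a * choose_weight a F"
proof (rule fps_ext)
  fix n
  have "real (Suc a) * real (n choose Suc a) = (real n - real a) * real (n choose a)"
  proof (cases "a \<le> n")
    case True
    have "Suc a * (n choose Suc a) = (n - a) * (n choose a)"
      using binomial_absorption[of a n] binomial_absorb_comp[of n a] by simp
    then have "real (Suc a * (n choose Suc a)) = real ((n - a) * (n choose a))"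
      by (rule arg_cong)
    then show ?thesis using True by (simp only: of_nat_mult of_nat_diff)
  qed (simp add: binomial_eq_0)
  then have "real (Suc a) * (real (n choose Suc a) * fps_nth F n) =
      real n * (real (n choose a) * fps_nth F n) - real a * (real (n choose a) * fps_nth F n)"
    by (metis (no_types, opaque_lifting) left_diff_distrib mult.assoc)
  then show "fps_nth (of_nat (Suc a) * choose_weight (Suc a) F) n =
      fps_nth (fps_X * fps_deriv (choose_weight a F) - of_nat a * choose_weight a F) n"
    by (simp add: fps_mult_fps_X_deriv_shift fps_of_nat [symmetric] choose_weight_def del: of_nat_Suc)
qed

lemma choose_weight_1: "choose_weight 1 F = fps_X * fps_deriv F"
  using choose_weight_Suc[of 0 F] by (simp add: choose_weight_0)

lemma choose_weight_2: "2 * choose_weight 2 F = fps_X * fps_deriv (choose_weight 1 F) - choose_weight 1 F"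
  using choose_weight_Suc[of 1 F] by (simp add: numeral_2_eq_2)

lemma choose_weight_3: "3 * choose_weight 3 F = fps_X * fps_deriv (choose_weight 2 F) - 2 * choose_weight 2 F"
  using choose_weight_Suc[of 2 F] by (simp add: numeral_3_eq_3 numeral_2_eq_2 fps_of_nat)

section \<open>Solving the equations by polynomials in two power series\<close>

text \<open>The series $1/(1-z)$ and $-\log(1-z)$; the constant term of the latter is $1/0 = 0$.\<close>

definition u :: "real fps" where "u = Abs_fps (\<lambda>_. 1)"
definition L :: "real fps" where "L = Abs_fps (\<lambda>n. 1 / real n)"

lemma one_minus_X_times_u: "(1 - fps_X) * u = 1"
  by (intro fps_ext) (simp add: u_def left_diff_distrib)

lemma X_times_u: "fps_X * u = u - 1"
  using one_minus_X_times_u by (simp add: algebra_simps)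

lemma fps_deriv_u: "fps_deriv u = u ^ 2"
  by (intro fps_ext) (simp add: u_def power2_eq_square fps_mult_nth)

lemma fps_deriv_L: "fps_deriv L = u"
  by (intro fps_ext) (simp add: u_def L_def)

text \<open>
  The product of $F - K$ and the integrating factor $(1-z)^2$ has derivative 0.
\<close>

lemma linear_ode_unique:
  assumes "fps_deriv F = 2 * u * F + T" "fps_deriv K = 2 * u * K + T" "fps_nth F 0 = fps_nth K 0"
  shows "F = K"
proof -
  define D where "D = F - K"
  have D: "fps_deriv D = 2 * u * D" "fps_nth D 0 = 0"
    using assms by (simp_all add: D_def algebra_simps)
  have "fps_deriv ((1 - fps_X) ^ 2 * D) = 2 * ((1 - fps_X) * u) * (1 - fps_X) * D - 2 * (1 - fps_X) * D"
    using D(1) by (simp add: power2_eq_square algebra_simps)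
  also have "\<dots> = 0"
    by (simp add: one_minus_X_times_u)
  finally have "(1 - fps_X) ^ 2 * D = fps_const (fps_nth ((1 - fps_X) ^ 2 * D) 0)"
    by (simp only: fps_deriv_eq_0_iff)
  then have "(1 - fps_X) ^ 2 * D = 0"
    using D(2) by simp
  then have "D = 0"
    using one_minus_X_times_u by (metis mult_eq_0_iff power_eq_0_iff zero_neq_one)
  then show ?thesis
    by (simp add: D_def)
qed

lemma nth_0: "fps_nth u 0 = 1" "fps_nth L 0 = 0"
  by (simp_all add: u_def L_def)

lemma moment_fps_0: "moment_fps 0 = u"
  by (intro fps_ext) (simp add: moment_fps_def u_def binomial_moment_def)

lemma nth_moment_fps_0: "r > 0 \<Longrightarrow> fps_nth (moment_fps r) 0 = 0"
  by (simp add: moment_fps_def binomial_moment_quicksort_swaps_le_1)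

lemma fps_const_fractions:
  "2 * fps_const (1 / 2 :: real) = 1"
  "3 * fps_const (1 / 3 :: real) = 1"
  "4 * fps_const (1 / 4 :: real) = 1"
  "6 * fps_const (1 / 6 :: real) = 1"
  "12 * fps_const (1 / 12 :: real) = 1"
  by (simp_all add: numeral_fps_const)

text \<open>
  The instances $r = 1, 2, 3$ of the differential equation with the symmetric terms collected. The
  fractions $a!\,b!/(a+b+1)!$ are cleared because series do not form a field.
\<close>

lemma deriv_moment_fps_1:
  "fps_deriv (moment_fps 1) = 2 * u * moment_fps 1 + u * choose_weight 1 u"
proof -
  have "fps_deriv (moment_fps 1) = 2 * u * moment_fps 1 + 2 * fps_const (1 / 2) * (u * choose_weight 1 u)"
    unfolding fps_deriv_moment_fps[of 1] by (simp add: moment_fps_0 choose_weight_0 mult_ac)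
  then show ?thesis by (simp only: fps_const_fractions mult_1)
qed

lemma deriv_moment_fps_2:
  "6 * fps_deriv (moment_fps 2) = 12 * u * moment_fps 2 + 6 * moment_fps 1 ^ 2
     + 6 * (u * choose_weight 1 (moment_fps 1) + moment_fps 1 * choose_weight 1 u)
     + 4 * u * choose_weight 2 u + choose_weight 1 u ^ 2"
proof -
  have "fps_deriv (moment_fps 2) = 2 * u * moment_fps 2 + moment_fps 1 ^ 2
     + 2 * fps_const (1 / 2) * (u * choose_weight 1 (moment_fps 1) + moment_fps 1 * choose_weight 1 u)
     + 2 * fps_const (1 / 3) * (u * choose_weight 2 u) + fps_const (1 / 6) * choose_weight 1 u ^ 2"
    unfolding fps_deriv_moment_fps[of 2]
    by (simp add: moment_fps_0 choose_weight_0 numeral_2_eq_2 algebra_simps)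
  then show ?thesis
    using fps_const_fractions by algebra
qed

lemma deriv_moment_fps_3:
  "12 * fps_deriv (moment_fps 3) = 24 * u * moment_fps 3 + 24 * moment_fps 1 * moment_fps 2
     + 12 * (choose_weight 1 u * moment_fps 2 + choose_weight 1 (moment_fps 1) * moment_fps 1
             + choose_weight 1 (moment_fps 2) * u)
     + 8 * (choose_weight 2 u * moment_fps 1 + choose_weight 2 (moment_fps 1) * u)
     + 4 * choose_weight 1 u * choose_weight 1 (moment_fps 1)
     + 6 * choose_weight 3 u * u + 2 * choose_weight 2 u * choose_weight 1 u"
proof -
  have "fps_deriv (moment_fps 3) = 2 * u * moment_fps 3 + 2 * moment_fps 1 * moment_fps 2
     + 2 * fps_const (1 / 2) * (choose_weight 1 u * moment_fps 2 + choose_weight 1 (moment_fps 1) * moment_fps 1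
             + choose_weight 1 (moment_fps 2) * u)
     + 2 * fps_const (1 / 3) * (choose_weight 2 u * moment_fps 1 + choose_weight 2 (moment_fps 1) * u)
     + 2 * fps_const (1 / 6) * choose_weight 1 u * choose_weight 1 (moment_fps 1)
     + 2 * fps_const (1 / 4) * choose_weight 3 u * u
     + 2 * fps_const (1 / 12) * choose_weight 2 u * choose_weight 1 u"
    unfolding fps_deriv_moment_fps[of 3]
    by (simp add: moment_fps_0 choose_weight_0 numeral_2_eq_2 numeral_3_eq_3 algebra_simps)
  then show ?thesis
    using fps_const_fractions by algebra
qed

text \<open>
  Writing out the powers lets the product rule act on products of \<open>u\<close> and \<open>L\<close> only, so that no
  factors from a power rule have to be normalised.
\<close>

lemmas uL_expand = fps_deriv_u fps_deriv_L power2_eq_square power3_eq_cube power4_eq_xxxx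

text \<open>In general $\binom na$ has the generating function $z^a u^{a+1} = u(u-1)^a$.\<close>

lemma choose_weight_u:
  "choose_weight 1 u = u * (u - 1)"
  "choose_weight 2 u = u * (u - 1) ^ 2"
  "choose_weight 3 u = u * (u - 1) ^ 3"
proof -
  show 1: "choose_weight 1 u = u * (u - 1)"
    unfolding choose_weight_1 fps_deriv_u using X_times_u by algebra
  have "fps_deriv (u * (u - 1)) = 2 * u ^ 3 - u ^ 2"
    by (simp add: uL_expand algebra_simps)
  then have "2 * choose_weight 2 u = 2 * (u * (u - 1) ^ 2)"
    using choose_weight_2[of u] X_times_u unfolding 1 by algebra
  then show 2: "choose_weight 2 u = u * (u - 1) ^ 2" by simp
  have "fps_deriv (u * (u - 1) ^ 2) = 3 * u ^ 4 - 4 * u ^ 3 + u ^ 2"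
    by (simp add: uL_expand algebra_simps)
  then have "3 * choose_weight 3 u = 3 * (u * (u - 1) ^ 3)"
    using choose_weight_3[of u] X_times_u unfolding 2 by algebra
  then show "choose_weight 3 u = u * (u - 1) ^ 3" by simp
qed

text \<open>
  The solutions come from the integration of $(1-z)^2 T$, where \<open>T\<close> is the inhomogeneous part: the
  primitives of $u^b L^a$ are again polynomials in \<open>L\<close>, \<open>u\<close> and $1/u$. Once found, they only have to
  be checked.
\<close>

lemma moment_fps_1: "moment_fps 1 = u ^ 2 * L + u - u ^ 2"
proof (rule linear_ode_unique)
  show "fps_deriv (moment_fps 1) = 2 * u * moment_fps 1 + u ^ 2 * (u - 1)"
    unfolding deriv_moment_fps_1 choose_weight_u by algebra
  show "fps_deriv (u ^ 2 * L + u - u ^ 2) = 2 * u * (u ^ 2 * L + u - u ^ 2) + u ^ 2 * (u - 1)"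
    by (simp add: uL_expand algebra_simps)
  show "fps_nth (moment_fps 1) 0 = fps_nth (u ^ 2 * L + u - u ^ 2) 0"
    by (simp add: nth_moment_fps_0 nth_0 uL_expand)
qed

lemma choose_weight_moment_fps_1:
  "choose_weight 1 (moment_fps 1) = (u - 1) * (2 * u ^ 2 * L - u ^ 2 + u)"
  "2 * choose_weight 2 (moment_fps 1) = (u - 1) ^ 2 * (6 * u ^ 2 * L - u ^ 2 + 2 * u)"
proof -
  have "fps_deriv (u ^ 2 * L + u - u ^ 2) = u * (2 * u ^ 2 * L - u ^ 2 + u)"
    by (simp add: uL_expand algebra_simps)
  then show 1: "choose_weight 1 (moment_fps 1) = (u - 1) * (2 * u ^ 2 * L - u ^ 2 + u)"
    unfolding choose_weight_1 moment_fps_1 using X_times_u by algebra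
  have "fps_deriv ((u - 1) * (2 * u ^ 2 * L - u ^ 2 + u)) =
      u ^ 2 * (2 * u ^ 2 * L - u ^ 2 + u) + (u - 1) * (4 * u ^ 3 * L + 2 * u ^ 3 - 2 * u ^ 3 + u ^ 2)"
    by (simp add: uL_expand algebra_simps)
  then show "2 * choose_weight 2 (moment_fps 1) = (u - 1) ^ 2 * (6 * u ^ 2 * L - u ^ 2 + 2 * u)"
    using choose_weight_2[of "moment_fps 1"] X_times_u unfolding 1 by algebra
qed

lemma moment_fps_2:
  "6 * moment_fps 2 = 6 * u ^ 3 * L ^ 2 - 3 * u ^ 2 * L ^ 2 - 6 * u ^ 3 * L + 2 * u ^ 2 * L
     + 5 * u ^ 3 - 6 * u ^ 2 + u" (is "_ = ?K")
proof (rule linear_ode_unique)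
  let ?T = "6 * u ^ 4 * L ^ 2 + 6 * u ^ 4 * L - 6 * u ^ 3 * L - u ^ 4 + 2 * u ^ 3 - u ^ 2"
  have "fps_deriv (6 * moment_fps 2) = 6 * fps_deriv (moment_fps 2)"
    by simp
  then show "fps_deriv (6 * moment_fps 2) = 2 * u * (6 * moment_fps 2) + ?T"
    using deriv_moment_fps_2 unfolding choose_weight_u choose_weight_moment_fps_1 unfolding moment_fps_1
    by algebra
  show "fps_deriv ?K = 2 * u * ?K + ?T"
    by (simp add: uL_expand algebra_simps)
  show "fps_nth (6 * moment_fps 2) 0 = fps_nth ?K 0"
    by (simp add: nth_moment_fps_0 nth_0 uL_expand)
qed

lemma choose_weight_moment_fps_2:
  "6 * choose_weight 1 (moment_fps 2) = (u - 1) * (18 * u ^ 3 * L ^ 2 - 6 * u ^ 2 * L ^ 2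
     - 6 * u ^ 3 * L - 2 * u ^ 2 * L + 9 * u ^ 3 - 10 * u ^ 2 + u)"
proof -
  have "6 * fps_deriv (moment_fps 2) = fps_deriv (6 * moment_fps 2)"
    by simp
  also have "\<dots> = u * (18 * u ^ 3 * L ^ 2 - 6 * u ^ 2 * L ^ 2
     - 6 * u ^ 3 * L - 2 * u ^ 2 * L + 9 * u ^ 3 - 10 * u ^ 2 + u)"
    unfolding moment_fps_2 by (simp add: uL_expand algebra_simps)
  finally show ?thesis
    unfolding choose_weight_1 using X_times_u by algebra
qed

lemma moment_fps_3:
  "12 * moment_fps 3 = 12 * u ^ 4 * L ^ 3 - 12 * u ^ 3 * L ^ 3 + 2 * u ^ 2 * L ^ 3
     - 6 * u ^ 4 * L ^ 2 - 10 * u ^ 3 * L ^ 2 + 8 * u ^ 2 * L ^ 2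
     + 18 * u ^ 4 * L - 20 * u ^ 3 * L + 12 * u ^ 2 * L
     - 3 * u ^ 4 - 4 * u ^ 3 + 7 * u ^ 2" (is "_ = ?K")
proof (rule linear_ode_unique)
  let ?T = "u ^ 3 * (24 * u ^ 2 * L ^ 3 - 12 * u * L ^ 3 + 24 * u ^ 2 * L ^ 2 - 46 * u * L ^ 2 + 6 * L ^ 2
     + 24 * u ^ 2 * L - 40 * u * L + 16 * L + 12 * u ^ 2 - 24 * u + 12)"
  have "fps_deriv (12 * moment_fps 3) = 12 * fps_deriv (moment_fps 3)"
    by simp
  also have "\<dots> = 2 * u * (12 * moment_fps 3) + (4 * moment_fps 1 + 2 * choose_weight 1 u) * (6 * moment_fps 2)
     + 12 * choose_weight 1 (moment_fps 1) * moment_fps 1 + 2 * u * (6 * choose_weight 1 (moment_fps 2))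
     + 8 * choose_weight 2 u * moment_fps 1 + 4 * u * (2 * choose_weight 2 (moment_fps 1))
     + 4 * choose_weight 1 u * choose_weight 1 (moment_fps 1)
     + 6 * choose_weight 3 u * u + 2 * choose_weight 2 u * choose_weight 1 u"
    unfolding deriv_moment_fps_3 by algebra
  also have "\<dots> = 2 * u * (12 * moment_fps 3) + ?T"
    unfolding choose_weight_u choose_weight_moment_fps_1 choose_weight_moment_fps_2 moment_fps_2
    unfolding moment_fps_1 by algebra
  finally show "fps_deriv (12 * moment_fps 3) = 2 * u * (12 * moment_fps 3) + ?T" .
  show "fps_deriv ?K = 2 * u * ?K + ?T"
    by (simp add: uL_expand algebra_simps)
  show "fps_nth (12 * moment_fps 3) 0 = fps_nth ?K 0"
    by (simp add: nth_moment_fps_0 nth_0 uL_expand)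
qed

section \<open>Extraction of coefficients\<close>

lemma nth_times_u: "fps_nth (F * u) n = (\<Sum>j\<le>n. fps_nth F j)"
  by (simp add: fps_mult_nth u_def atMost_atLeast0)

lemma H_0: "H k 0 = 0" and H_Suc: "H k (Suc n) = H k n + (1 / (real n + 1)) ^ k"
  by (simp_all add: H_def add.commute power_one_over)

lemma fps_deriv_u_power_L_power:
  "fps_deriv (u ^ b * L ^ a) =
     fps_const (real b) * (u ^ Suc b * L ^ a) + fps_const (real a) * (u ^ Suc b * L ^ (a - 1))"
proof -
  have u: "fps_deriv (u ^ b) = fps_const (real b) * u ^ Suc b"
    by (subst fps_deriv_power) (cases b; simp add: fps_deriv_u power2_eq_square mult_ac)
  have L: "fps_deriv (L ^ a) = fps_const (real a) * (u * L ^ (a - 1))"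
    by (subst fps_deriv_power) (simp add: fps_deriv_L mult_ac)
  show ?thesis
    unfolding fps_deriv_mult u L by (simp add: mult_ac)
qed

text \<open>
  Multiplication by \<open>u\<close> forms partial sums, and the coefficients of $L^a$ follow from
  $(L^a)' = a u L^{a-1}$.
\<close>

lemma nth_uL_Suc:
  "fps_nth (u * L ^ a) (Suc n) =
     fps_nth (u * L ^ a) n + real a / (real n + 1) * fps_nth (u * L ^ (a - 1)) n"
proof -
  have "fps_nth (u * L ^ a) (Suc n) = fps_nth (u * L ^ a) n + fps_nth (L ^ a) (Suc n)"
    by (simp add: mult.commute[of u] nth_times_u)
  moreover have "(real n + 1) * fps_nth (L ^ a) (Suc n) = real a * fps_nth (u * L ^ (a - 1)) n"
    using arg_cong[OF fps_deriv_u_power_L_power[of 0 a], of "\<lambda>F. fps_nth F n"] by (simp add: add.commute)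
  ultimately show ?thesis
    by (simp add: field_simps)
qed

text \<open>
  The coefficient of $z^n$ in $z D (u^b L^a)$, computed in two ways: as \<open>n\<close> times a coefficient, and
  by the product rule with $zu = u - 1$. The index \<open>n\<close> is the same in all terms, so that an
  iteration over \<open>b\<close> does not involve harmonic numbers of shifted index.
\<close>

lemma nth_u_power_Suc:
  "real b * fps_nth (u ^ Suc b * L ^ a) n =
     (real n + real b) * fps_nth (u ^ b * L ^ a) n
     + real a * (fps_nth (u ^ b * L ^ (a - 1)) n - fps_nth (u ^ Suc b * L ^ (a - 1)) n)"
proof -
  have X: "fps_X * (u ^ Suc b * F) = u ^ Suc b * F - u ^ b * F" for F
  proof -
    have "fps_X * (u ^ Suc b * F) = (fps_X * u) * (u ^ b * F)"
      by (simp add: mult_ac)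
    also have "\<dots> = (u - 1) * (u ^ b * F)"
      by (simp only: X_times_u)
    also have "\<dots> = u ^ Suc b * F - u ^ b * F"
      by (simp add: algebra_simps)
    finally show ?thesis .
  qed
  have "fps_X * fps_deriv (u ^ b * L ^ a) =
      fps_const (real b) * (u ^ Suc b * L ^ a - u ^ b * L ^ a)
      + fps_const (real a) * (u ^ Suc b * L ^ (a - 1) - u ^ b * L ^ (a - 1))"
    unfolding fps_deriv_u_power_L_power X [symmetric] by (simp only: distrib_left mult.left_commute)
  from arg_cong[OF this, of "\<lambda>F. fps_nth F n"]
  have "real n * fps_nth (u ^ b * L ^ a) n =
      real b * (fps_nth (u ^ Suc b * L ^ a) n - fps_nth (u ^ b * L ^ a) n)
      + real a * (fps_nth (u ^ Suc b * L ^ (a - 1)) n - fps_nth (u ^ b * L ^ (a - 1)) n)"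
    by (simp only: fps_mult_fps_X_deriv_shift fps_nth_Abs_fps fps_add_nth fps_sub_nth fps_mult_left_const_nth)
  then show ?thesis
    by (simp only: algebra_simps)
qed

text \<open>
  Divided by $a!$ these are the elementary symmetric polynomials in $1, 1/2, \dots, 1/n$, because
  $e^{tL} u = (1-z)^{-1-t}$ has the coefficients $\prod_{i\le n} (1 + t/i)$; the right-hand sides
  express them by power sums.
\<close>

lemma nth_u_1:
  "fps_nth u n = 1"
  "fps_nth (u * L) n = H 1 n"
  "fps_nth (u * L ^ 2) n = H 1 n ^ 2 - H 2 n"
  "fps_nth (u * L ^ 3) n = H 1 n ^ 3 - 3 * H 1 n * H 2 n + 2 * H 3 n"
proof -
  show 0: "fps_nth u n = 1" for n by (simp add: u_def)
  show 1: "fps_nth (u * L) n = H 1 n" for n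
  proof (induction n)
    case (Suc n)
    then show ?case using nth_uL_Suc[of 1 n] by (simp add: 0 H_Suc)
  qed (simp add: H_0 L_def)
  show 2: "fps_nth (u * L ^ 2) n = H 1 n ^ 2 - H 2 n" for n
  proof (induction n)
    case (Suc n)
    define w where "w = 1 / (real n + 1)"
    have "fps_nth (u * L ^ 2) (Suc n) = H 1 n ^ 2 - H 2 n + 2 * w * H 1 n"
      using nth_uL_Suc[of 2 n] 1[of n] by (simp add: Suc w_def)
    also have "\<dots> = (H 1 n + w ^ 1) ^ 2 - (H 2 n + w ^ 2)"
      by (simp add: power2_eq_square algebra_simps del: One_nat_def)
    finally show ?case
      unfolding H_Suc w_def .
  qed (simp add: H_0 L_def)
  show "fps_nth (u * L ^ 3) n = H 1 n ^ 3 - 3 * H 1 n * H 2 n + 2 * H 3 n" for n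
  proof (induction n)
    case (Suc n)
    define w where "w = 1 / (real n + 1)"
    have "fps_nth (u * L ^ 3) (Suc n) =
        H 1 n ^ 3 - 3 * H 1 n * H 2 n + 2 * H 3 n + 3 * w * (H 1 n ^ 2 - H 2 n)"
      using nth_uL_Suc[of 3 n] 2[of n] by (simp add: Suc w_def)
    also have "\<dots> = (H 1 n + w ^ 1) ^ 3 - 3 * (H 1 n + w ^ 1) * (H 2 n + w ^ 2) + 2 * (H 3 n + w ^ 3)"
      by (simp add: power2_eq_square power3_eq_cube algebra_simps del: One_nat_def)
    finally show ?case
      unfolding H_Suc w_def .
  qed (simp add: H_0 L_def)
qed

text \<open>
  Expansion of $(x - \mu)^3$ in the basis $\binom xj$, where the mean $\mu$ is the first binomial
  moment.
\<close>

lemma third_central_moment: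
  assumes "finite (set_pmf p)"
  defines "B \<equiv> binomial_moment p"
  shows "measure_pmf.expectation p (\<lambda>x. (real x - measure_pmf.expectation p real) ^ 3) =
    6 * B 3 + 6 * B 2 + B 1 - 3 * B 1 * (2 * B 2 + B 1) + 2 * B 1 ^ 3"
proof -
  have mean: "measure_pmf.expectation p real = B 1"
    by (simp add: B_def binomial_moment_def)
  have 2: "2 * real (x choose 2) = real x * (real x - 1)" for x
    by (simp add: binomial_gbinomial gbinomial_prod_rev numeral_2_eq_2)
  have 3: "6 * real (x choose 3) = real x * (real x - 1) * (real x - 2)" for x
    by (simp add: binomial_gbinomial gbinomial_prod_rev numeral_3_eq_3)
  have "(real x - B 1) ^ 3 = 6 * real (x choose 3) + (6 - 6 * B 1) * real (x choose 2)
      + (1 - 3 * B 1 + 3 * B 1 ^ 2) * real (x choose 1) - B 1 ^ 3" for x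
    using 2[of x] 3[of x] unfolding choose_one by algebra
  then have "measure_pmf.expectation p (\<lambda>x. (real x - B 1) ^ 3) =
      measure_pmf.expectation p (\<lambda>x. 6 * real (x choose 3) + (6 - 6 * B 1) * real (x choose 2)
      + (1 - 3 * B 1 + 3 * B 1 ^ 2) * real (x choose 1) - B 1 ^ 3)"
    by simp
  also have "\<dots> = 6 * B 3 + (6 - 6 * B 1) * B 2 + (1 - 3 * B 1 + 3 * B 1 ^ 2) * B 1 - B 1 ^ 3"
  proof -
    have "measure_pmf.expectation p (\<lambda>x. a * real (x choose 3) + b * real (x choose 2) + c * real (x choose 1) - d) =
        a * B 3 + b * B 2 + c * B 1 - d" for a b c d
      unfolding B_def binomial_moment_def
      by (simp add: integrable_measure_pmf_finite[OF assms(1)] del: choose_one)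
    then show ?thesis .
  qed
  also have "\<dots> = 6 * B 3 + 6 * B 2 + B 1 - 3 * B 1 * (2 * B 2 + B 1) + 2 * B 1 ^ 3"
    by algebra
  finally show ?thesis unfolding mean .
qed

lemma fps_numeral_mult_nth: "fps_nth (numeral k * F) n = numeral k * fps_nth (F :: real fps) n"
  by (simp add: numeral_fps_const)

text \<open>
  The values are kept linear in the coefficients of $u L^a$; their harmonic forms matter only for
  the central moment, where the nonlinear terms cancel.
\<close>

lemma binomial_moments_quicksort_swaps:
  fixes n :: nat
  defines "x \<equiv> real n" and "B \<equiv> binomial_moment (quicksort_swaps n)"
    and "E \<equiv> \<lambda>a. fps_nth (u * L ^ a) n"
  shows "B 1 = (x + 1) * E 1 - 2 * x"
    and "B 2 = (x + 1) ^ 2 / 2 * E 2 - 2 * (x + 1) * (3 * x + 1) / 3 * E 1 + x * (35 * x + 29) / 12"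
    and "B 3 = (x + 1) ^ 3 / 6 * E 3 - (x + 1) ^ 2 * (3 * x + 2) / 3 * E 2
      + 5 * (x + 1) ^ 2 * (7 * x + 2) / 12 * E 1 - x * (32 * x ^ 2 + 66 * x + 37) / 9"
proof -
  define c where "c = (\<lambda>b a. fps_nth (u ^ b * L ^ a) n)"
  have B: "B 1 = c 2 1 + c 1 0 - c 2 0"
    "6 * B 2 = 6 * c 3 2 - 3 * c 2 2 - 6 * c 3 1 + 2 * c 2 1 + 5 * c 3 0 - 6 * c 2 0 + c 1 0"
    "12 * B 3 = 12 * c 4 3 - 12 * c 3 3 + 2 * c 2 3 - 6 * c 4 2 - 10 * c 3 2 + 8 * c 2 2
      + 18 * c 4 1 - 20 * c 3 1 + 12 * c 2 1 - 3 * c 4 0 - 4 * c 3 0 + 7 * c 2 0"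
    using arg_cong[OF moment_fps_1, of "\<lambda>F. fps_nth F n"]
      arg_cong[OF moment_fps_2, of "\<lambda>F. fps_nth F n"]
      arg_cong[OF moment_fps_3, of "\<lambda>F. fps_nth F n"]
    by (simp_all add: fps_numeral_mult_nth mult.assoc moment_fps_def B_def c_def)
  have c1: "c 1 0 = 1" "c 1 a = E a" for a
    by (simp_all add: c_def E_def nth_u_1)
  have rec: "real b * c (Suc b) a = (x + real b) * c b a + real a * (c b (a - 1) - c (Suc b) (a - 1))" for a b
    unfolding c_def x_def by (rule nth_u_power_Suc)
  have c2: "c 2 a = (x + 1) * c 1 a + real a * (c 1 (a - 1) - c 2 (a - 1))"
    and c3: "c 3 a = ((x + 2) * c 2 a + real a * (c 2 (a - 1) - c 3 (a - 1))) / 2"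
    and c4: "c 4 a = ((x + 3) * c 3 a + real a * (c 3 (a - 1) - c 4 (a - 1))) / 3" for a
    using rec[of 1 a] rec[of 2 a] rec[of 3 a] by (simp_all add: eval_nat_numeral)
  (* Each value of a gets its own equation: as a rewrite rule the general recursion would loop at
     a = 0, where a - 1 truncates to 0. *)
  have c2': "c 2 0 = x + 1" "c 2 1 = (x + 1) * E 1 + (1 - c 2 0)"
    "c 2 2 = (x + 1) * E 2 + 2 * (E 1 - c 2 1)" "c 2 3 = (x + 1) * E 3 + 3 * (E 2 - c 2 2)"
    using c2[of 0] c2[of 1] c2[of 2] c2[of 3] c1(1) c1(2)[of 1] c1(2)[of 2] c1(2)[of 3] by simp_all
  have c3': "c 3 0 = (x + 2) * c 2 0 / 2" "c 3 1 = ((x + 2) * c 2 1 + (c 2 0 - c 3 0)) / 2"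
    "c 3 2 = ((x + 2) * c 2 2 + 2 * (c 2 1 - c 3 1)) / 2"
    "c 3 3 = ((x + 2) * c 2 3 + 3 * (c 2 2 - c 3 2)) / 2"
    using c3[of 0] c3[of 1] c3[of 2] c3[of 3] by simp_all
  have c4': "c 4 0 = (x + 3) * c 3 0 / 3" "c 4 1 = ((x + 3) * c 3 1 + (c 3 0 - c 4 0)) / 3"
    "c 4 2 = ((x + 3) * c 3 2 + 2 * (c 3 1 - c 4 1)) / 3"
    "c 4 3 = ((x + 3) * c 3 3 + 3 * (c 3 2 - c 4 2)) / 3"
    using c4[of 0] c4[of 1] c4[of 2] c4[of 3] by simp_all
  show "B 1 = (x + 1) * E 1 - 2 * x"
    unfolding B c2' c1(1) by algebra
  have "6 * B 2 = 6 * ((x + 1) ^ 2 / 2 * E 2 - 2 * (x + 1) * (3 * x + 1) / 3 * E 1 + x * (35 * x + 29) / 12)"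
    unfolding B c3' c2' c1(1) by (simp add: field_simps power2_eq_square)
  then show "B 2 = (x + 1) ^ 2 / 2 * E 2 - 2 * (x + 1) * (3 * x + 1) / 3 * E 1 + x * (35 * x + 29) / 12"
    by (simp only: mult_cancel_left rel_simps simp_thms)
  have "12 * B 3 = 12 * ((x + 1) ^ 3 / 6 * E 3 - (x + 1) ^ 2 * (3 * x + 2) / 3 * E 2
      + 5 * (x + 1) ^ 2 * (7 * x + 2) / 12 * E 1 - x * (32 * x ^ 2 + 66 * x + 37) / 9)"
    unfolding B c4' c3' c2' c1(1) by (simp add: field_simps power2_eq_square power3_eq_cube)
  then show "B 3 = (x + 1) ^ 3 / 6 * E 3 - (x + 1) ^ 2 * (3 * x + 2) / 3 * E 2
      + 5 * (x + 1) ^ 2 * (7 * x + 2) / 12 * E 1 - x * (32 * x ^ 2 + 66 * x + 37) / 9"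
    by (simp only: mult_cancel_left rel_simps simp_thms)
qed

theorem theorem4p11:
  fixes n :: nat
  assumes "n \<ge> 1"
  shows "measure_pmf.expectation (quicksort_swaps n)
      (\<lambda>x. (real x - measure_pmf.expectation (quicksort_swaps n) (\<lambda>y. real y)) ^ 3) =
    - (1 / 6) * real n * (14 * real n ^ 2 + 57 * real n + 73)
    + (2 * real n + 2) * H 1 n + (real n + 1) ^ 2 * H 2 n + 2 * (real n + 1) ^ 3 * H 3 n"
proof -
  define x where "x = real n"
  define h1 h2 h3 where "h1 = H 1 n" and "h2 = H 2 n" and "h3 = H 3 n"
  define B where "B = binomial_moment (quicksort_swaps n)"
  have E: "fps_nth (u * L ^ 1) n = h1" "fps_nth (u * L ^ 2) n = h1 ^ 2 - h2"
    "fps_nth (u * L ^ 3) n = h1 ^ 3 - 3 * h1 * h2 + 2 * h3"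
    by (simp_all add: nth_u_1 h1_def h2_def h3_def)
  have B1: "B 1 = (x + 1) * h1 - 2 * x"
    and B2: "B 2 = (x + 1) ^ 2 / 2 * (h1 ^ 2 - h2) - 2 * (x + 1) * (3 * x + 1) / 3 * h1 + x * (35 * x + 29) / 12"
    and B3: "B 3 = (x + 1) ^ 3 / 6 * (h1 ^ 3 - 3 * h1 * h2 + 2 * h3)
      - (x + 1) ^ 2 * (3 * x + 2) / 3 * (h1 ^ 2 - h2)
      + 5 * (x + 1) ^ 2 * (7 * x + 2) / 12 * h1 - x * (32 * x ^ 2 + 66 * x + 37) / 9"
    using binomial_moments_quicksort_swaps[of n] unfolding E B_def x_def by blast+
  have "6 * B 3 + 6 * B 2 + B 1 - 3 * B 1 * (2 * B 2 + B 1) + 2 * B 1 ^ 3 =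
    - (1 / 6) * x * (14 * x ^ 2 + 57 * x + 73)
    + (2 * x + 2) * h1 + (x + 1) ^ 2 * h2 + 2 * (x + 1) ^ 3 * h3"
    unfolding B1 B2 B3 by (simp add: field_simps power2_eq_square power3_eq_cube)
  then show ?thesis
    using third_central_moment[OF finite_quicksort_swaps[of n], folded B_def]
    unfolding x_def h1_def h2_def h3_def by simp
qed

end
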